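(* Let $(\pi,\rho,V)$ be a complex representation of the real Lie supergroup $S^{1|1}$ such that the weight spaces $\{v\in V: t\cdot v=t^m v \text{ for all } t\in S^1\}$, $m\in\mathbb Z$, for the reduced group $S^1$ are all finite-dimensional. Then $(\pi,\rho,V)$ is isomorphic to $$\bigoplus_i V_i\oplus U\oplus\bigoplus_j W_j,$$ where the $V_i$ are super weight spaces, i.e. each is one of the $1|1$-dimensional representations attached to a nonzero integer $m$ described in the context (repeated according to their multiplicities), $U$ is a trivial representation, and each $W_j$ is isomorphic to $\mathrm{Ad}(S^{1|1})$ or to $\Pi\,\mathrm{Ad}(S^{1|1})$.
   Context: The real Lie supergroup $S^{1|1}$ is described by the super Harish-Chandra pair consisting of the reduced group $S^1$ and the real Lie superalgebra $\mathfrak g=\mathrm{Lie}(S^{1|1})=\langle C,Z\rangle$ of dimension $1|1$, with $C$ even spanning $\mathrm{Lie}(S^1)$, $Z$ odd, and brackets $[C,C]=[C,Z]=0$, $[Z,Z]=-2C$; $S^1$ acts trivially on $\mathfrak g$ by the adjoint action. A (complex) representation $(\pi,\rho,V)$ of $S^{1|1}$ is a complex super vector space $V=V_{\bar 0}\oplus V_{\bar 1}$ with a representation $\pi$ of $S^1$ on $V$ by even (parity-preserving) linear automorphisms and a Lie superalgebra morphism $\rho:\mathfrak g\to\mathrm{End}(V)$ (so $\rho(C)$ is even, $\rho(Z)$ is odd and $2\rho(Z)^2=-2\rho(C)$), such that $\rho(C)=d\pi(C)$ and $\rho(Z)$ commutes with $\pi(S^1)$; $C$ is normalized so that $\rho(C)$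 acts as $im$ on vectors on which $t\in S^1$ acts by $t^m$. Isomorphisms of representations are even linear isomorphisms intertwining $\pi$ and $\rho$. A representation is trivial if $\pi$ is trivial and $\rho=0$ (the underlying super vector space may have any dimension). For each integer $m\neq0$, the super weight space attached to $m$ is the $1|1$-dimensional representation with homogeneous basis $v_0$ (even), $v_1$ (odd), on which $t\in S^1$ acts by $t^m$ and $Z\cdot v_0=\sqrt{-im}\,v_1$, $Z\cdot v_1=\sqrt{-im}\,v_0$ (for a fixed choice of square root). $\mathrm{Ad}(S^{1|1})$ denotes the (complexified) adjoint representation, which is isomorphic to the $1|1$-dimensional representation with basis $w_0$ (even), $w_1$ (odd), trivial $S^1$-action, and $Z\cdot w_0=0$, $Z\cdot w_1=w_0$. Its parity reversal $\Pi\,\mathrm{Ad}(S^{1|1})$ is isomorphic to the $1|1$-dimensional representation with basis $w_0$ (even), $w_1$ (odd), trivial $S^1$-action, and $Z\cdot w_0=w_1$, $Z\cdot w_1=0$. *)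

theory Defs
  imports "HOL-Analysis.Analysis" "HOL-Library.Z2" "HOL-Library.Function_Algebras"
begin

section \<open>Complex vector spaces\<close>

class complex_vector = ab_group_add +
  fixes scaleC :: "complex \<Rightarrow> 'a \<Rightarrow> 'a"  (infixr \<open>*\<^sub>C\<close> 75)
  assumes scaleC_add_right: "a *\<^sub>C (x + y) = a *\<^sub>C x + a *\<^sub>C y"
    and scaleC_add_left: "(a + b) *\<^sub>C x = a *\<^sub>C x + b *\<^sub>C x"
    and scaleC_scaleC: "a *\<^sub>C b *\<^sub>C x = (a * b) *\<^sub>C x"
    and scaleC_one: "1 *\<^sub>C x = x"

interpretation complex_vector: vector_space "scaleC :: complex \<Rightarrow> 'a \<Rightarrow> 'a::complex_vector"
  by unfold_locales (simp_all add: scaleC_add_right scaleC_add_left scaleC_scaleC scaleC_one)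

instantiation complex :: complex_vector
begin
definition scaleC_complex :: "complex \<Rightarrow> complex \<Rightarrow> complex"
  where "scaleC_complex c x = c * x"
instance by standard (simp_all add: scaleC_complex_def algebra_simps)
end

instantiation prod :: (complex_vector, complex_vector) complex_vector
begin
definition scaleC_prod :: "complex \<Rightarrow> 'a \<times> 'b \<Rightarrow> 'a \<times> 'b"
  where "scaleC_prod c x = (c *\<^sub>C fst x, c *\<^sub>C snd x)"
instance
  by standard (simp_all add: scaleC_prod_def scaleC_add_right scaleC_add_left scaleC_scaleC scaleC_one)
end

instantiation "fun" :: (type, complex_vector) complex_vector
begin
definition scaleC_fun :: "complex \<Rightarrow> ('a \<Rightarrow> 'b) \<Rightarrow> 'a \<Rightarrow> 'b"
  where "scaleC_fun c f = (\<lambda>x. c *\<^sub>C f x)"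
instance
  by standard (simp_all add: scaleC_fun_def fun_eq_iff scaleC_add_right scaleC_add_left
      scaleC_scaleC scaleC_one)
end


section \<open>The super Harish-Chandra pair of the supercircle\<close>

abbreviation circle :: "complex set"
  where "circle \<equiv> sphere 0 1"

text \<open>Parities are elements of the two-element field \<^typ>\<open>bit\<close>.  The following is the grading of
  a free module of rank \<open>1|1\<close>: even first coordinate, odd second coordinate.\<close>

definition std_part :: "bit \<Rightarrow> ('a::zero \<times> 'a) set"
  where "std_part p = (if p = 0 then {x. snd x = 0} else {x. fst x = 0})"

text \<open>The real Lie superalgebra \<open>\<langle>C, Z\<rangle>\<close> is \<^typ>\<open>real \<times> real\<close>, where \<open>(a, b)\<close> stands for
  \<open>a C + b Z\<close>, graded by \<^const>\<open>std_part\<close>.  The bracket is polymorphic in the scalars so that it also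
  describes the complexification; it is the bilinear extension of \<open>[C,C] = [C,Z] = 0\<close>,
  \<open>[Z,Z] = -2C\<close>.\<close>

definition lie_C :: "real \<times> real" where "lie_C = (1, 0)"
definition lie_Z :: "real \<times> real" where "lie_Z = (0, 1)"

definition lie_bracket :: "'a::comm_ring_1 \<times> 'a \<Rightarrow> 'a \<times> 'a \<Rightarrow> 'a \<times> 'a"
  where "lie_bracket x y = (- 2 * (snd x * snd y), 0)"


section \<open>Representations\<close>

text \<open>\<open>act\<close> is the action of the circle and \<open>lie\<close> that of the Lie superalgebra.  The underlying
  space is a subspace of the ambient type, namely the sum of the two homogeneous parts; \<open>act\<close> and
  \<open>lie\<close> are only meaningful on the circle and on this subspace.\<close>

record 'v super_rep =
  part :: "bit \<Rightarrow> 'v set"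
  act :: "complex \<Rightarrow> 'v \<Rightarrow> 'v"
  lie :: "real \<times> real \<Rightarrow> 'v \<Rightarrow> 'v"

definition space_of :: "'v::complex_vector super_rep \<Rightarrow> 'v set"
  where "space_of R = {x + y | x y. x \<in> part R 0 \<and> y \<in> part R 1}"

definition linear_on :: "'v::complex_vector set \<Rightarrow> ('v \<Rightarrow> 'w::complex_vector) \<Rightarrow> bool"
  where "linear_on S f \<longleftrightarrow>
    (\<forall>x\<in>S. \<forall>y\<in>S. f (x + y) = f x + f y) \<and> (\<forall>c. \<forall>x\<in>S. f (c *\<^sub>C x) = c *\<^sub>C f x)"

definition super_space :: "'v::complex_vector super_rep \<Rightarrow> bool"
  where "super_space R \<longleftrightarrow>
    (\<forall>p. complex_vector.subspace (part R p)) \<and> part R 0 \<inter> part R 1 = {0}"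

definition circle_rep :: "'v::complex_vector super_rep \<Rightarrow> bool"
  where "circle_rep R \<longleftrightarrow>
    (\<forall>t\<in>circle. linear_on (space_of R) (act R t) \<and> (\<forall>p. act R t ` part R p \<subseteq> part R p)) \<and>
    (\<forall>v\<in>space_of R. act R 1 v = v) \<and>
    (\<forall>s\<in>circle. \<forall>t\<in>circle. \<forall>v\<in>space_of R. act R (s * t) v = act R s (act R t v))"

definition lie_rep :: "'v::complex_vector super_rep \<Rightarrow> bool"
  where "lie_rep R \<longleftrightarrow>
    (\<forall>X. linear_on (space_of R) (lie R X)) \<and>
    (\<forall>v\<in>space_of R. \<forall>X Y. lie R (X + Y) v = lie R X v + lie R Y v) \<and>
    (\<forall>v\<in>space_of R. \<forall>r X. lie R (r *\<^sub>R X) v = complex_of_real r *\<^sub>C lie R X v) \<and>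
    (\<forall>p q. \<forall>X\<in>std_part p. lie R X ` part R q \<subseteq> part R (p + q)) \<and>
    (\<forall>p q. \<forall>X\<in>std_part p. \<forall>Y\<in>std_part q. \<forall>v\<in>space_of R.
      lie R (lie_bracket X Y) v =
        lie R X (lie R Y v) - (if p * q = 1 then - 1 else 1) *\<^sub>C lie R Y (lie R X v))"

text \<open>\<open>\<rho>(C) = d\<pi>(C)\<close>: the vector \<open>\<rho>(C) v\<close> is the derivative at \<open>\<theta> = 0\<close> of \<open>\<pi>(e^(i\<theta>)) v\<close>.  The space
  carries no topology, so the derivative is taken after applying an arbitrary linear functional
  (every functional on a subspace extends to the ambient space).  If the space is
  finite-dimensional, this is the usual derivative.  In general it implies that all matrix
  coefficients are continuous on the compact circle, hence that every orbit spans a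
  finite-dimensional subspace, on which it is again the usual derivative.\<close>

definition differential_compatible :: "'v::complex_vector super_rep \<Rightarrow> bool"
  where "differential_compatible R \<longleftrightarrow>
    (\<forall>v\<in>space_of R. \<forall>f :: 'v \<Rightarrow> complex. Vector_Spaces.linear scaleC scaleC f \<longrightarrow>
      ((\<lambda>\<theta>. f (act R (cis \<theta>) v)) has_vector_derivative f (lie R lie_C v)) (at 0))"

definition supercircle_rep :: "'v::complex_vector super_rep \<Rightarrow> bool"
  where "supercircle_rep R \<longleftrightarrow>
    super_space R \<and> circle_rep R \<and> lie_rep R \<and> differential_compatible R \<and>
    (\<forall>t\<in>circle. \<forall>v\<in>space_of R. lie R lie_Z (act R t v) = act R t (lie R lie_Z v))"

definition weight_space :: "'v::complex_vector super_rep \<Rightarrow> int \<Rightarrow> 'v set"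
  where "weight_space R m = {v \<in> space_of R. \<forall>t\<in>circle. act R t v = (t powi m) *\<^sub>C v}"

definition finite_dim :: "'v::complex_vector set \<Rightarrow> bool"
  where "finite_dim S \<longleftrightarrow> (\<exists>B. finite B \<and> S \<subseteq> complex_vector.span B)"

definition rep_isomorphic :: "'v::complex_vector super_rep \<Rightarrow> 'w::complex_vector super_rep \<Rightarrow> bool"
  where "rep_isomorphic R S \<longleftrightarrow> supercircle_rep R \<and> supercircle_rep S \<and>
    (\<exists>\<phi>. bij_betw \<phi> (space_of R) (space_of S) \<and> linear_on (space_of R) \<phi> \<and>
      (\<forall>p. \<phi> ` part R p = part S p) \<and>
      (\<forall>t\<in>circle. \<forall>v\<in>space_of R. \<phi> (act R t v) = act S t (\<phi> v)) \<and>
      (\<forall>X. \<forall>v\<in>space_of R. \<phi> (lie R X v) = lie S X (\<phi> v)))"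

definition trivial_rep :: "'v::complex_vector super_rep \<Rightarrow> bool"
  where "trivial_rep R \<longleftrightarrow> supercircle_rep R \<and>
    (\<forall>t\<in>circle. \<forall>v\<in>space_of R. act R t v = v) \<and> (\<forall>X. \<forall>v\<in>space_of R. lie R X v = 0)"

definition parity_reversal :: "'v super_rep \<Rightarrow> 'v super_rep"
  where "parity_reversal R = R\<lparr>part := \<lambda>p. part R (p + 1)\<rparr>"


section \<open>The indecomposable summands\<close>

text \<open>In both representations \<^typ>\<open>complex \<times> complex\<close> has even first and odd second coordinate.\<close>

definition super_weight_rep :: "int \<Rightarrow> (complex \<times> complex) super_rep"
  where "super_weight_rep m =
    \<lparr>part = std_part,
     act = (\<lambda>t v. (t powi m) *\<^sub>C v),
     lie = (\<lambda>X v. (of_real (fst X) * (\<i> * of_int m)) *\<^sub>C v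
       + (of_real (snd X) * csqrt (- (\<i> * of_int m))) *\<^sub>C prod.swap v)\<rparr>"

text \<open>The complexified Lie superalgebra, on which the circle acts trivially and the Lie
  superalgebra acts by the bracket.\<close>

definition adjoint_rep :: "(complex \<times> complex) super_rep"
  where "adjoint_rep =
    \<lparr>part = std_part,
     act = (\<lambda>t v. v),
     lie = (\<lambda>X v. lie_bracket (map_prod of_real of_real X) v)\<rparr>"


section \<open>Direct sums\<close>

definition rep_Sum :: "'i set \<Rightarrow> ('i \<Rightarrow> 'v::complex_vector super_rep) \<Rightarrow> ('i \<Rightarrow> 'v) super_rep"
  where "rep_Sum I R =
    \<lparr>part = (\<lambda>p. {f. finite {i. f i \<noteq> 0} \<and> (\<forall>i\<in>I. f i \<in> part (R i) p) \<and> (\<forall>i. i \<notin> I \<longrightarrow> f i = 0)}),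
     act = (\<lambda>t f i. if i \<in> I then act (R i) t (f i) else 0),
     lie = (\<lambda>X f i. if i \<in> I then lie (R i) X (f i) else 0)\<rparr>"

definition rep_plus :: "'v super_rep \<Rightarrow> 'w super_rep \<Rightarrow> ('v \<times> 'w) super_rep"
    (infixr \<open>\<oplus>\<^sub>R\<close> 65)
  where "R \<oplus>\<^sub>R S =
    \<lparr>part = (\<lambda>p. part R p \<times> part S p),
     act = (\<lambda>t. map_prod (act R t) (act S t)),
     lie = (\<lambda>X. map_prod (lie R X) (lie S X))\<rparr>"

end

theory Submission
  imports Defs "HOL-Computational_Algebra.Fundamental_Theorem_Algebra"
begin

text \<open>
  Write \<open>A = \<rho>(C)\<close> and \<open>Z = \<rho>(Z)\<close>, so that \<open>Z\<^sup>2 = - A\<close>.  Every matrix coefficient of the circle is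
  continuous, hence bounded, so an orbit cannot contain an infinite independent set: a functional
  could be chosen unbounded on it.  Its span is therefore finite-dimensional and \<open>A\<close>-invariant, and
  every vector is annihilated by a polynomial in \<open>A\<close>.  Since \<open>\<theta> \<mapsto> \<pi>(e\<^sup>i\<^sup>\<theta>)\<close> is periodic, \<open>A\<close> has no
  Jordan blocks and its eigenvalues are \<open>im\<close> with \<open>m\<close> an integer, so the space is spanned by
  weight vectors.

  On the range of \<open>A\<close>, which carries the nonzero weights, \<open>Z\<close> is injective, so a basis of even weight
  vectors \<open>e\<close> yields super weight spaces spanned by \<open>e\<close> and \<open>Z e\<close>.  On weight zero \<open>Z\<close> is a
  differential, \<open>Z\<^sup>2 = 0\<close>: homogeneous lifts \<open>g\<close> of a basis of the range of \<open>Z\<close> yield the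
  adjoint pieces spanned by \<open>g\<close> and \<open>Z g\<close>, and a graded complement of the range of \<open>Z\<close> in its kernel
  is the trivial summand.
\<close>

section \<open>Linear algebra\<close>

text \<open>The space carries no topology, so neither averaging over the circle nor differentiating
  a vector-valued curve is directly available. Every analytic statement concerns a scalar function
  \<open>f (act R (cis \<theta>) v)\<close> and is returned to vectors because linear functionals
  separate points from subspaces. This is why weight vectors come from a polynomial identity in
  \<open>A\<close> and not from Fourier projections. The weights are never separated from one
  another: semisimplicity at eigenvalue 0 makes kernel and range of \<open>A\<close> meet in 0, and
  this one splitting suffices. Odd vectors of nonzero weight get no basis of their own, since
  \<open>Z\<close> sends them to even ones and \<open>Z (Z v)\<close> is a nonzero multiple of
  \<open>v\<close>. The isomorphism is built from the model to \<open>R\<close>: an injective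
  intertwiner pulls the axioms back, so the total direct sum is not checked axiom by axiom. Finite
  dimension of the weight spaces makes the chosen bases countable, which permits sets of natural
  numbers as index sets.\<close>

interpretation complex_vector_pair: vector_space_pair
  "scaleC :: complex \<Rightarrow> 'a \<Rightarrow> 'a::complex_vector" "scaleC :: complex \<Rightarrow> 'b \<Rightarrow> 'b::complex_vector"
  by unfold_locales

lemma linear_onI:
  assumes "\<And>x y. x \<in> S \<Longrightarrow> y \<in> S \<Longrightarrow> f (x + y) = f x + f y"
    and "\<And>c x. x \<in> S \<Longrightarrow> f (c *\<^sub>C x) = c *\<^sub>C f x"
  shows "linear_on S f"
  using assms by (simp add: linear_on_def)

context
  fixes S :: "'a::complex_vector set" and f :: "'a \<Rightarrow> 'b::complex_vector"
  assumes lin: "linear_on S f"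
begin

lemma linear_on_add: "x \<in> S \<Longrightarrow> y \<in> S \<Longrightarrow> f (x + y) = f x + f y"
  and linear_on_scale: "x \<in> S \<Longrightarrow> f (c *\<^sub>C x) = c *\<^sub>C f x"
  using lin by (simp_all add: linear_on_def)

lemma linear_on_subset: "T \<subseteq> S \<Longrightarrow> linear_on T f"
  using lin unfolding linear_on_def by blast

context
  assumes sub: "complex_vector.subspace S"
begin

lemma linear_on_zero: "f 0 = 0"
  using linear_on_scale[of 0 0] complex_vector.subspace_0[OF sub] by simp

lemma linear_on_minus: "x \<in> S \<Longrightarrow> f (- x) = - f x"
  using linear_on_scale[of x "-1"] by simp

lemma linear_on_diff: "x \<in> S \<Longrightarrow> y \<in> S \<Longrightarrow> f (x - y) = f x - f y"
  using linear_on_add[of x "- y"] linear_on_minus[of y] complex_vector.subspace_neg[OF sub] by simp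

lemma linear_on_sum: "(\<And>i. i \<in> F \<Longrightarrow> x i \<in> S) \<Longrightarrow> f (sum x F) = (\<Sum>i\<in>F. f (x i))"
proof (induction F rule: infinite_finite_induct)
  case (insert i F)
  then show ?case
    using linear_on_add[of "x i" "sum x F"] complex_vector.subspace_sum[OF sub, of F x] by simp
qed (simp_all add: linear_on_zero)

lemma linear_on_image_subspace: "complex_vector.subspace (f ` S)"
  unfolding complex_vector.subspace_def
proof (intro conjI ballI allI)
  show "0 \<in> f ` S"
    using linear_on_zero complex_vector.subspace_0[OF sub] by force
next
  fix x y assume "x \<in> f ` S" "y \<in> f ` S"
  then show "x + y \<in> f ` S"
    using linear_on_add complex_vector.subspace_add[OF sub] by (auto simp: image_iff) metis
next
  fix c x assume "x \<in> f ` S"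
  then show "c *\<^sub>C x \<in> f ` S"
    using linear_on_scale complex_vector.subspace_scale[OF sub] by (auto simp: image_iff) metis
qed

lemma linear_on_kernel_subspace: "complex_vector.subspace {x \<in> S. f x = 0}"
  using linear_on_zero sub linear_on_add linear_on_scale
  by (auto simp: complex_vector.subspace_def)

text \<open>Linear combinations are lifted term by term. Since \<open>f\<close> is linear only on
  \<open>S\<close>, membership in \<open>S\<close> has to travel through the span induction.\<close>

lemma linear_on_span_preimage:
  assumes "B \<subseteq> S" "y \<in> complex_vector.span (f ` B)"
  obtains x where "x \<in> complex_vector.span B" "f x = y"
proof -
  have "\<exists>x. x \<in> complex_vector.span B \<and> x \<in> S \<and> f x = y"
    using assms(2)
  proof (induction rule: complex_vector.span_induct_alt)
    case base
    then show ?case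
      using linear_on_zero complex_vector.subspace_0[OF sub] complex_vector.span_zero by blast
  next
    case (step c z y)
    then obtain x b where "x \<in> complex_vector.span B" "x \<in> S" "f x = y" "b \<in> B" "z = f b"
      by auto
    moreover from this have "b \<in> S" "c *\<^sub>C b \<in> S"
      using assms(1) complex_vector.subspace_scale[OF sub] by auto
    ultimately show ?case
      by (intro exI[of _ "c *\<^sub>C b + x"])
        (simp add: linear_on_add linear_on_scale complex_vector.subspace_add[OF sub]
          complex_vector.span_add complex_vector.span_scale complex_vector.span_base)
  qed
  then show thesis using that by blast
qed

text \<open>\<open>differential_compatible\<close> quantifies over functionals of the whole type, so
  one that is given on a subspace must be extended. A basis of \<open>S\<close> stays independent in
  the ambient space, hence values on it can be prescribed there.\<close>

lemma linear_on_extend: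
  obtains g where "Vector_Spaces.linear scaleC scaleC g" "\<And>x. x \<in> S \<Longrightarrow> g x = f x"
proof -
  obtain B where B: "B \<subseteq> S" "complex_vector.independent B" "S \<subseteq> complex_vector.span B"
    using complex_vector.maximal_independent_subset by blast
  obtain g where g: "Vector_Spaces.linear scaleC scaleC g" "\<forall>x\<in>B. g x = f x"
    using complex_vector_pair.linear_independent_extend[OF B(2), of f] by (elim exE conjE)
  have "g x = f x" if "x \<in> S" for x
  proof -
    have "x \<in> complex_vector.span B"
      using that B(3) by blast
    then have "x \<in> S \<and> g x = f x"
    proof (induction rule: complex_vector.span_induct_alt)
      case base
      then show ?case
        by (simp add: linear_on_zero complex_vector.subspace_0[OF sub] complex_vector_pair.linear_0[OF g(1)])
    next
      case (step c b y)
      then have "b \<in> S" "c *\<^sub>C b \<in> S"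
        using B(1) complex_vector.subspace_scale[OF sub] by auto
      with step show ?case
        by (simp add: linear_on_add linear_on_scale complex_vector.subspace_add[OF sub] g(2)
            complex_vector_pair.linear_add[OF g(1)] complex_vector_pair.linear_scale[OF g(1)])
    qed
    then show ?thesis ..
  qed
  with g(1) show thesis by (rule that)
qed

end

end

lemma linear_on_comp:
  "linear_on S f \<Longrightarrow> linear_on T g \<Longrightarrow> f ` S \<subseteq> T \<Longrightarrow> linear_on S (\<lambda>x. g (f x))"
  by (simp add: linear_on_def image_subset_iff)

lemma linear_imp_linear_on: "Vector_Spaces.linear scaleC scaleC f \<Longrightarrow> linear_on S f"
  by (simp add: linear_on_def complex_vector_pair.linear_add complex_vector_pair.linear_scale)

text \<open>Adjoining \<open>x\<close> to a basis of the span keeps it independent, so the value 1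
  at \<open>x\<close> and 0 on the basis may be prescribed. In limit arguments this stands in for
  closedness of subspaces.\<close>

lemma separating_functional:
  fixes x :: "'a::complex_vector"
  assumes "x \<notin> complex_vector.span S"
  obtains f :: "'a \<Rightarrow> complex" where "Vector_Spaces.linear scaleC scaleC f"
    "\<And>y. y \<in> complex_vector.span S \<Longrightarrow> f y = 0" "f x = 1"
proof -
  obtain B where B: "B \<subseteq> S" "complex_vector.independent B" "S \<subseteq> complex_vector.span B"
    using complex_vector.maximal_independent_subset by blast
  have sp: "complex_vector.span B = complex_vector.span S"
    using B by (meson complex_vector.span_minimal complex_vector.span_mono complex_vector.subspace_span subset_antisym)
  then have "complex_vector.independent (insert x B)"
    using assms B by (simp add: complex_vector.independent_insertI)
  then obtain f :: "'a \<Rightarrow> complex" where f: "Vector_Spaces.linear scaleC scaleC f"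
    "\<And>y. y \<in> insert x B \<Longrightarrow> f y = (if y = x then 1 else 0)"
    using complex_vector_pair.linear_independent_extend[of "insert x B" "\<lambda>y. if y = x then 1 else 0"]
    by blast
  have "x \<notin> B"
    using assms sp complex_vector.span_base by blast
  have "f y = 0" if "y \<in> complex_vector.span S" for y
  proof (rule complex_vector_pair.linear_eq_0_on_span[OF f(1)])
    show "y \<in> complex_vector.span B"
      using that sp by simp
    show "f z = 0" if "z \<in> B" for z
      using that f(2) \<open>x \<notin> B\<close> by auto
  qed
  with f show thesis
    using that by auto
qed

text \<open>Turns identities between scalar functions back into identities of vectors: a nonzero
  difference lies outside the span of the empty set.\<close>

lemma functionals_separate:
  fixes x y :: "'a::complex_vector"
  assumes "\<And>f :: 'a \<Rightarrow> complex. Vector_Spaces.linear scaleC scaleC f \<Longrightarrow> f x = f y"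
  shows "x = y"
proof (rule ccontr)
  assume "x \<noteq> y"
  then have "x - y \<notin> complex_vector.span {}"
    by simp
  then obtain f :: "'a \<Rightarrow> complex" where f: "Vector_Spaces.linear scaleC scaleC f" "f (x - y) = 1"
    by (metis separating_functional)
  with assms[OF f(1)] show False
    by (simp add: complex_vector_pair.linear_diff)
qed

text \<open>A left inverse of the inclusion of \<open>S\<close> is a projection onto
  \<open>S\<close>; its kernel inside \<open>T\<close> is the complement.\<close>

lemma subspace_complement:
  fixes S T :: "'a::complex_vector set"
  assumes "complex_vector.subspace S" "complex_vector.subspace T" "S \<subseteq> T"
  obtains U where "complex_vector.subspace U" "U \<subseteq> T" "U \<inter> S = {0}"
    "\<And>x. x \<in> T \<Longrightarrow> \<exists>s\<in>S. \<exists>u\<in>U. x = s + u"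
proof -
  have "Vector_Spaces.linear scaleC scaleC (\<lambda>x::'a. x)"
    using complex_vector.linear_id by (simp add: id_def)
  from complex_vector_pair.linear_exists_left_inverse_on[OF this assms(1)]
  obtain \<pi> where \<pi>: "range \<pi> \<subseteq> S" "Vector_Spaces.linear scaleC scaleC \<pi>" "\<And>x. x \<in> S \<Longrightarrow> \<pi> x = x"
    by auto
  let ?U = "{x \<in> T. \<pi> x = 0}"
  have "complex_vector.subspace ?U"
    using linear_on_kernel_subspace[OF linear_imp_linear_on[OF \<pi>(2)] assms(2)] .
  moreover have "?U \<inter> S = {0}"
    using \<pi> assms by (force simp: complex_vector.subspace_0 complex_vector_pair.linear_0)
  moreover have "\<exists>s\<in>S. \<exists>u\<in>?U. x = s + u" if "x \<in> T" for x
  proof (intro bexI)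
    have *: "\<pi> x \<in> S" using \<pi>(1) by auto
    then show "\<pi> x \<in> S" .
    show "x - \<pi> x \<in> ?U"
      using that * assms \<pi> by (auto simp: complex_vector_pair.linear_diff complex_vector.subspace_diff)
  qed simp
  ultimately show thesis
    using that by blast
qed

lemma independent_finite_dim_imp_finite:
  assumes "complex_vector.independent B" "B \<subseteq> S" "finite_dim S"
  shows "finite B"
  using assms complex_vector.independent_span_bound unfolding finite_dim_def by blast

lemma obtain_nat_enumeration:
  assumes "countable B"
  obtains I :: "nat set" and e where "bij_betw e I B"
proof -
  obtain f :: "'a \<Rightarrow> nat" where "inj_on f B"
    using assms by (auto simp: countable_def)
  then have "bij_betw (inv_into B f) (f ` B) B"
    by (simp add: bij_betw_inv_into inj_on_imp_bij_betw)
  then show thesis by (rule that)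
qed

lemma linear_on_inj_onI:
  assumes "linear_on S f" "complex_vector.subspace S" "\<And>x. x \<in> S \<Longrightarrow> f x = 0 \<Longrightarrow> x = 0"
  shows "inj_on f S"
proof (rule inj_onI)
  fix x y assume *: "x \<in> S" "y \<in> S" "f x = f y"
  then have "x - y = 0"
    using assms(3)[of "x - y"] linear_on_diff[OF assms(1,2)] complex_vector.subspace_diff[OF assms(2)]
    by simp
  then show "x = y" by simp
qed

text \<open>Independence is a property of sets of vectors; injectivity of \<open>e\<close> lets
  coefficients attached to indices be read as coefficients attached to vectors.\<close>

lemma independent_family_sum_zero:
  assumes "complex_vector.independent (e ` I)" "inj_on e I" "finite F" "F \<subseteq> I"
    "(\<Sum>i\<in>F. c i *\<^sub>C e i) = 0" "i \<in> F"
  shows "c i = 0"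
proof -
  have inj: "inj_on e F"
    using assms(2,4) by (rule inj_on_subset)
  have "(\<Sum>v\<in>e ` F. c (inv_into F e v) *\<^sub>C v) = (\<Sum>i\<in>F. c i *\<^sub>C e i)"
    unfolding sum.reindex[OF inj] comp_def by (rule sum.cong) (use inj in auto)
  then have "c (inv_into F e (e i)) = 0"
    using assms by (intro complex_vector.independentD[OF assms(1), of "e ` F"]) auto
  then show ?thesis
    using inj assms(6) by simp
qed

section \<open>Annihilating polynomials\<close>

text \<open>This is \<open>p(A) v\<close>, evaluated at one vector because \<open>A\<close> is
  linear only on a subspace of the type.\<close>

definition poly_op :: "('a::complex_vector \<Rightarrow> 'a) \<Rightarrow> complex poly \<Rightarrow> 'a \<Rightarrow> 'a"
  where "poly_op A p v = (\<Sum>i\<le>degree p. coeff p i *\<^sub>C (A ^^ i) v)"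

lemma poly_op_eq_sum:
  assumes "degree p \<le> n"
  shows "poly_op A p v = (\<Sum>i\<le>n. coeff p i *\<^sub>C (A ^^ i) v)"
  unfolding poly_op_def
  by (rule sum.mono_neutral_left) (use assms in \<open>auto simp: coeff_eq_0\<close>)

text \<open>The first \<open>card B + 1\<close> iterates lie in a span of \<open>card B\<close>
  vectors, so they satisfy a relation. As dependence speaks of sets, a repetition among the iterates
  is a separate case, with the relation given by the difference of two equal iterates.\<close>

lemma annihilating_poly_exists:
  assumes "finite B" "\<And>n. (A ^^ n) v \<in> complex_vector.span B"
  obtains p where "p \<noteq> 0" "poly_op A p v = 0"
proof -
  define n where "n = card B"
  have "\<exists>c. (\<exists>i\<le>n. c i \<noteq> 0) \<and> (\<Sum>i\<le>n. c i *\<^sub>C (A ^^ i) v) = 0"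
  proof (cases "inj_on (\<lambda>i. (A ^^ i) v) {..n}")
    case True
    let ?X = "(\<lambda>i. (A ^^ i) v) ` {..n}"
    have "card ?X = Suc n"
      using True by (simp add: card_image)
    then have "complex_vector.dependent ?X"
      using complex_vector.independent_span_bound[OF assms(1), of ?X] assms(2)
      by (auto simp: n_def)
    then obtain u where "(\<exists>x\<in>?X. u x \<noteq> 0)" "(\<Sum>x\<in>?X. u x *\<^sub>C x) = 0"
      by (auto simp: complex_vector.dependent_finite)
    then show ?thesis
      by (intro exI[of _ "\<lambda>i. u ((A ^^ i) v)"]) (auto simp: sum.reindex[OF True])
  next
    case False
    then obtain i j where ij: "i \<le> n" "j \<le> n" "i \<noteq> j" "(A ^^ i) v = (A ^^ j) v"
      by (auto simp: inj_on_def)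
    let ?c = "\<lambda>k. (if k = i then 1 else 0) + (if k = j then - 1 else 0) :: complex"
    have "(\<Sum>k\<le>n. ?c k *\<^sub>C (A ^^ k) v) =
        (\<Sum>k\<le>n. if k = i then (A ^^ k) v else 0) + (\<Sum>k\<le>n. if k = j then - (A ^^ k) v else 0)"
      unfolding sum.distrib[symmetric] by (rule sum.cong) (auto simp: scaleC_add_left)
    also have "\<dots> = 0"
      using ij by simp
    finally show ?thesis
      using ij by (intro exI[of _ ?c]) auto
  qed
  then obtain c i where c: "i \<le> n" "c i \<noteq> 0" "(\<Sum>i\<le>n. c i *\<^sub>C (A ^^ i) v) = 0"
    by blast
  define p where "p = (\<Sum>k\<le>n. monom (c k) k)"
  have coeff: "coeff p k = (if k \<le> n then c k else 0)" for k
    by (simp add: p_def coeff_sum if_distrib cong: if_cong)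
  have "degree p \<le> n"
    by (rule degree_le) (simp add: coeff)
  then have "poly_op A p v = 0"
    using c(3) by (simp add: poly_op_eq_sum coeff)
  moreover have "p \<noteq> 0"
    using coeff[of i] c by auto
  ultimately show thesis
    using that by blast
qed

context
  fixes V :: "'a::complex_vector set" and A :: "'a \<Rightarrow> 'a"
  assumes sub: "complex_vector.subspace V" and lin: "linear_on V A" and closed: "A ` V \<subseteq> V"
begin

lemma funpow_closed: "v \<in> V \<Longrightarrow> (A ^^ n) v \<in> V"
  using closed by (induction n) auto

lemma linear_on_funpow: "linear_on V (A ^^ n)"
proof (induction n)
  case (Suc n)
  then show ?case
    using linear_on_comp[OF Suc lin] funpow_closed by (auto simp: comp_def)
qed (simp add: linear_on_def)

text \<open>The linear factor is applied first, so if the product annihilates \<open>v\<close>, then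
  \<open>q\<close> annihilates \<open>A v - a v\<close>. This is the descent in degree used
  below.\<close>

lemma poly_op_linear_factor:
  assumes "v \<in> V"
  shows "poly_op A ([:- a, 1:] * q) v = poly_op A q (A v - a *\<^sub>C v)"
proof -
  let ?n = "degree q"
  have Av: "A v \<in> V" "a *\<^sub>C v \<in> V"
    using assms closed complex_vector.subspace_scale[OF sub] by auto
  have pow: "(A ^^ i) (A v - a *\<^sub>C v) = (A ^^ Suc i) v - a *\<^sub>C (A ^^ i) v" for i
    using assms Av linear_on_diff[OF linear_on_funpow sub] linear_on_scale[OF linear_on_funpow]
    by (simp add: funpow_swap1)
  have eq: "[:- a, 1:] * q = pCons 0 q - smult a q"
    by simp
  have "poly_op A ([:- a, 1:] * q) v
      = (\<Sum>i\<le>Suc ?n. coeff ([:- a, 1:] * q) i *\<^sub>C (A ^^ i) v)"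
    by (rule poly_op_eq_sum) (use degree_mult_le[of "[:- a, 1:]" q] in simp)
  also have "\<dots> = (\<Sum>i\<le>Suc ?n. coeff (pCons 0 q) i *\<^sub>C (A ^^ i) v)
      - (\<Sum>i\<le>Suc ?n. (a * coeff q i) *\<^sub>C (A ^^ i) v)"
    unfolding eq by (simp only: coeff_diff coeff_smult complex_vector.scale_left_diff_distrib sum_subtractf)
  also have "(\<Sum>i\<le>Suc ?n. coeff (pCons 0 q) i *\<^sub>C (A ^^ i) v) = (\<Sum>i\<le>?n. coeff q i *\<^sub>C (A ^^ Suc i) v)"
    by (simp only: sum.atMost_Suc_shift coeff_pCons_0 coeff_pCons_Suc) simp
  also have "(\<Sum>i\<le>Suc ?n. (a * coeff q i) *\<^sub>C (A ^^ i) v) = (\<Sum>i\<le>?n. (a * coeff q i) *\<^sub>C (A ^^ i) v)"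
    by (simp add: coeff_eq_0)
  also have "(\<Sum>i\<le>?n. coeff q i *\<^sub>C (A ^^ Suc i) v) - \<dots> = poly_op A q (A v - a *\<^sub>C v)"
    unfolding poly_op_def pow
    by (simp add: sum_subtractf complex_vector.scale_right_diff_distrib scaleC_scaleC mult.commute)
  finally show ?thesis .
qed

text \<open>The assumption \<open>semisimple\<close> says that \<open>(A - a)^2 v = 0\<close> forces
  \<open>(A - a) v = 0\<close>. Splitting off a root \<open>a\<close> of \<open>p\<close>, the
  vector \<open>(A - a) v\<close> is a sum of eigenvectors by induction; up to an
  \<open>a\<close>-eigenvector it is again \<open>(A - a) u\<close> for a sum \<open>u\<close> of
  eigenvectors, and then \<open>v - u\<close> is itself an eigenvector.\<close>

lemma annihilated_imp_in_span_eigenvectors: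
  assumes semisimple: "\<And>a v. v \<in> V \<Longrightarrow> A (A v - a *\<^sub>C v) = a *\<^sub>C (A v - a *\<^sub>C v) \<Longrightarrow> A v = a *\<^sub>C v"
    and "p \<noteq> 0" "v \<in> V" "poly_op A p v = 0"
  shows "v \<in> complex_vector.span {w \<in> V. \<exists>a. A w = a *\<^sub>C w}"
  using assms(2-)
proof (induction "degree p" arbitrary: p v)
  case 0
  then obtain c where "p = [:c:]" "c \<noteq> 0"
    by (metis degree_eq_zeroE pCons_0_0)
  with 0 show ?case
    by (simp add: poly_op_def complex_vector.span_zero)
next
  case (Suc n)
  let ?E = "{w \<in> V. \<exists>a. A w = a *\<^sub>C w}"
  have "\<not> constant (poly p)"
    using Suc(2) constant_degree[of p] by simp
  then obtain a where "poly p a = 0"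
    using fundamental_theorem_of_algebra by blast
  then obtain q where q: "p = [:- a, 1:] * q"
    by (auto simp: poly_eq_0_iff_dvd)
  then have "q \<noteq> 0" "degree q = n"
    using Suc by (auto simp: degree_mult_eq simp del: mult_pCons_left)
  have Av: "A v \<in> V" "a *\<^sub>C v \<in> V" "A v - a *\<^sub>C v \<in> V"
    using Suc closed complex_vector.subspace_scale[OF sub] complex_vector.subspace_diff[OF sub] by auto
  have "A v - a *\<^sub>C v \<in> complex_vector.span ?E"
    using Suc(1)[of q "A v - a *\<^sub>C v"] \<open>q \<noteq> 0\<close> \<open>degree q = n\<close> Av Suc q
    by (simp add: poly_op_linear_factor del: mult_pCons_left)
  \<comment> \<open>On an eigenvector for \<open>b\<close> the operator \<open>A - a\<close> is
    multiplication by \<open>b - a\<close>. Terms with \<open>b = a\<close> are collected in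
    \<open>w\<close>, all others are in the range of \<open>A - a\<close> and go to
    \<open>u\<close>.\<close>
  then have "\<exists>u w. u \<in> V \<and> u \<in> complex_vector.span ?E \<and> w \<in> V \<and> A w = a *\<^sub>C w \<and>
      A v - a *\<^sub>C v = (A u - a *\<^sub>C u) + w"
  proof (induction rule: complex_vector.span_induct_alt)
    case base
    show ?case
      using complex_vector.subspace_0[OF sub] linear_on_zero[OF lin sub] complex_vector.span_zero
      by (intro exI[of _ 0]) auto
  next
    case (step c x y)
    then obtain u w b where *: "u \<in> V" "u \<in> complex_vector.span ?E" "w \<in> V" "A w = a *\<^sub>C w"
      "y = (A u - a *\<^sub>C u) + w" "x \<in> V" "A x = b *\<^sub>C x"
      by auto
    show ?case
    proof (cases "b = a")
      case True
      show ?thesis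
      proof (rule exI[of _ u], rule exI[of _ "w + c *\<^sub>C x"], intro conjI)
        show "w + c *\<^sub>C x \<in> V"
          using * by (simp add: complex_vector.subspace_add[OF sub] complex_vector.subspace_scale[OF sub])
        show "A (w + c *\<^sub>C x) = a *\<^sub>C (w + c *\<^sub>C x)"
          using * True by (simp add: linear_on_add[OF lin] linear_on_scale[OF lin]
              complex_vector.subspace_scale[OF sub] scaleC_add_right scaleC_scaleC mult.commute)
        show "c *\<^sub>C x + y = A u - a *\<^sub>C u + (w + c *\<^sub>C x)"
          using * by simp
      qed (use * in auto)
    next
      case False
      \<comment> \<open>Chosen so that \<open>A - a\<close> maps \<open>?d\<close> times
        \<open>x\<close> to \<open>c\<close> times \<open>x\<close>.\<close>
      let ?d = "c / (b - a)"
      have dx: "?d *\<^sub>C x \<in> V"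
        using * by (simp add: complex_vector.subspace_scale[OF sub])
      show ?thesis
      proof (rule exI[of _ "u + ?d *\<^sub>C x"], rule exI[of _ w], intro conjI)
        show "u + ?d *\<^sub>C x \<in> V"
          using * dx by (simp add: complex_vector.subspace_add[OF sub])
        show "u + ?d *\<^sub>C x \<in> complex_vector.span ?E"
        proof (rule complex_vector.span_add[OF *(2) complex_vector.span_scale])
          show "x \<in> complex_vector.span ?E"
            using * by (auto intro: complex_vector.span_base)
        qed
        have "A (u + ?d *\<^sub>C x) - a *\<^sub>C (u + ?d *\<^sub>C x)
            = (A u - a *\<^sub>C u) + ((?d * b) *\<^sub>C x - (?d * a) *\<^sub>C x)"
          using * dx by (simp add: linear_on_add[OF lin] linear_on_scale[OF lin] scaleC_add_right
              scaleC_scaleC mult.commute)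
        also have "(?d * b) *\<^sub>C x - (?d * a) *\<^sub>C x = (?d * (b - a)) *\<^sub>C x"
          by (simp only: complex_vector.scale_left_diff_distrib[symmetric] right_diff_distrib)
        finally have "A (u + ?d *\<^sub>C x) - a *\<^sub>C (u + ?d *\<^sub>C x)
            = (A u - a *\<^sub>C u) + (?d * (b - a)) *\<^sub>C x" .
        then show "c *\<^sub>C x + y = A (u + ?d *\<^sub>C x) - a *\<^sub>C (u + ?d *\<^sub>C x) + w"
          using False * by simp
      qed (use * in auto)
    qed
  qed
  then obtain u w where *: "u \<in> V" "u \<in> complex_vector.span ?E" "w \<in> V" "A w = a *\<^sub>C w"
    "A v - a *\<^sub>C v = (A u - a *\<^sub>C u) + w"
    by blast
  have vu: "v - u \<in> V"
    using * Suc complex_vector.subspace_diff[OF sub] by blast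
  have "A (v - u) - a *\<^sub>C (v - u) = w"
    using * Suc by (simp add: linear_on_diff[OF lin sub] complex_vector.scale_right_diff_distrib algebra_simps)
  \<comment> \<open>Since \<open>w\<close> is an \<open>a\<close>-eigenvector, \<open>v - u\<close>
    is killed by \<open>(A - a)^2\<close>, which is where semisimplicity applies.\<close>
  with *(4) have "A (A (v - u) - a *\<^sub>C (v - u)) = a *\<^sub>C (A (v - u) - a *\<^sub>C (v - u))"
    by (simp only:)
  then have "v - u \<in> ?E"
    using semisimple[OF vu] vu by blast
  then have "(v - u) + u \<in> complex_vector.span ?E"
    by (rule complex_vector.span_add[OF complex_vector.span_base *(2)])
  then show ?case by simp
qed

end

section \<open>Representations of the supercircle\<close>

text \<open>The parameters range over a closed interval, so that compactness bounds continuous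
  functions on the circle.\<close>

lemma in_circle_iff_cis: "t \<in> circle \<longleftrightarrow> (\<exists>\<theta>\<in>{- pi..pi}. t = cis \<theta>)"
proof
  assume "t \<in> circle"
  then have "norm t = 1" "t \<noteq> 0"
    by auto
  then have "t = cis (Arg t)"
    by (simp add: cis_Arg sgn_div_norm)
  moreover have "Arg t \<in> {- pi..pi}"
    using Arg_bounded[of t] by auto
  ultimately show "\<exists>\<theta>\<in>{- pi..pi}. t = cis \<theta>"
    by blast
qed auto

lemma cis_in_circle: "cis \<theta> \<in> circle"
  by simp

lemma scaleC_complex [simp]: "(c::complex) *\<^sub>C x = c * x"
  by (simp add: scaleC_complex_def)

lemma bit_all_iff: "(\<forall>p::bit. P p) \<longleftrightarrow> P 0 \<and> P 1"
  by (metis bit_not_zero_iff)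

lemma part_subset_space_of:
  assumes "\<And>p. complex_vector.subspace (part R p)"
  shows "part R p \<subseteq> space_of R"
proof
  fix x assume x: "x \<in> part R p"
  have "0 \<in> part R q" for q
    using assms complex_vector.subspace_0 by blast
  moreover have "x = x + 0" "x = 0 + x"
    by simp_all
  ultimately show "x \<in> space_of R"
    using x unfolding space_of_def by (cases p) blast+
qed

lemma subspace_space_of:
  "(\<And>p. complex_vector.subspace (part R p)) \<Longrightarrow> complex_vector.subspace (space_of R)"
  unfolding space_of_def by (rule complex_vector.subspace_sums)

text \<open>These simplification rules would rewrite the parity \<open>p + 1\<close> into bit operations.\<close>

declare add_bit_eq_xor [simp del] mult_bit_eq_and [simp del]

section \<open>The operators \<open>A\<close> and \<open>Z\<close> and their commutation
  rules\<close>

locale supercircle =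
  fixes R :: "'v::complex_vector super_rep"
  assumes rep: "supercircle_rep R"
begin

abbreviation V :: "'v set" where "V \<equiv> space_of R"
abbreviation A :: "'v \<Rightarrow> 'v" where "A \<equiv> lie R lie_C"
abbreviation Z :: "'v \<Rightarrow> 'v" where "Z \<equiv> lie R lie_Z"

lemma super_space: "super_space R" and circle_rep: "circle_rep R" and lie_rep: "lie_rep R"
  and differential: "differential_compatible R"
  and Z_act: "\<And>t v. t \<in> circle \<Longrightarrow> v \<in> V \<Longrightarrow> Z (act R t v) = act R t (Z v)"
  using rep unfolding supercircle_rep_def by blast+

lemma part_subspace: "complex_vector.subspace (part R p)"
  using super_space by (simp add: super_space_def)

lemma parts_disjoint: "x \<in> part R p \<Longrightarrow> x \<in> part R (p + 1) \<Longrightarrow> x = 0"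
  using super_space by (cases p) (auto simp: super_space_def)

lemma part_subset: "part R p \<subseteq> V"
  by (rule part_subset_space_of) (rule part_subspace)

lemma V_subspace: "complex_vector.subspace V"
  by (rule subspace_space_of) (rule part_subspace)

lemmas V_closed = complex_vector.subspace_0[OF V_subspace] complex_vector.subspace_add[OF V_subspace]
  complex_vector.subspace_scale[OF V_subspace] complex_vector.subspace_diff[OF V_subspace]
  complex_vector.subspace_neg[OF V_subspace]

lemmas part_closed = complex_vector.subspace_0[OF part_subspace]
  complex_vector.subspace_add[OF part_subspace] complex_vector.subspace_scale[OF part_subspace]
  complex_vector.subspace_diff[OF part_subspace] complex_vector.subspace_neg[OF part_subspace]

lemma V_split:
  assumes "v \<in> V"
  obtains x y where "x \<in> part R p" "y \<in> part R (p + 1)" "v = x + y"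
proof -
  obtain x y where *: "x \<in> part R 0" "y \<in> part R 1" "v = x + y"
    using assms by (auto simp: space_of_def)
  show thesis
    using that[of x y] that[of y x] * by (cases p) (simp_all add: add.commute)
qed

text \<open>The vector \<open>x - x' = y' - y\<close> has both parities, hence vanishes.\<close>

lemma split_eq:
  assumes "x \<in> part R p" "x' \<in> part R p" "y \<in> part R (p + 1)" "y' \<in> part R (p + 1)" "x + y = x' + y'"
  shows "x = x'" "y = y'"
proof -
  have "x - x' = y' - y"
    using assms(5) by (simp add: algebra_simps)
  then have "x - x' \<in> part R p" "x - x' \<in> part R (p + 1)"
    using assms part_closed(4)[of x p x'] part_closed(4)[of y' "p + 1" y] by auto
  then have "x - x' = 0"
    by (rule parts_disjoint)
  with assms(5) show "x = x'" "y = y'"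
    by auto
qed

lemmas circle_repD = circle_rep[unfolded circle_rep_def]

lemma act_linear: "t \<in> circle \<Longrightarrow> linear_on V (act R t)"
  by (rule circle_repD[THEN conjunct1, THEN bspec, THEN conjunct1])

lemma act_part: "t \<in> circle \<Longrightarrow> x \<in> part R p \<Longrightarrow> act R t x \<in> part R p"
  by (rule circle_repD[THEN conjunct1, THEN bspec, THEN conjunct2, THEN spec, THEN subsetD, OF _ imageI])

lemma act_V:
  assumes "t \<in> circle" "v \<in> V"
  shows "act R t v \<in> V"
proof -
  obtain x y where *: "x \<in> part R 0" "y \<in> part R 1" "v = x + y"
    using assms(2) by (auto simp: space_of_def)
  then have "x \<in> V" "y \<in> V"
    using part_subset by blast+
  moreover have "act R t x \<in> V" "act R t y \<in> V"
    using * assms(1) act_part part_subset by blast+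
  ultimately show ?thesis
    by (simp add: *(3) linear_on_add[OF act_linear[OF assms(1)]] V_closed)
qed

lemma act_one: "v \<in> V \<Longrightarrow> act R 1 v = v"
  by (rule circle_repD[THEN conjunct2, THEN conjunct1, THEN bspec])

lemma act_mult: "s \<in> circle \<Longrightarrow> t \<in> circle \<Longrightarrow> v \<in> V \<Longrightarrow> act R (s * t) v = act R s (act R t v)"
  by (rule circle_repD[THEN conjunct2, THEN conjunct2, THEN bspec, THEN bspec, THEN bspec])

lemmas lie_repD = lie_rep[unfolded lie_rep_def]

lemma lie_linear: "linear_on V (lie R X)"
  by (rule lie_repD[THEN conjunct1, THEN spec])

lemma lie_add_left: "v \<in> V \<Longrightarrow> lie R (X + Y) v = lie R X v + lie R Y v"
  by (rule lie_repD[THEN conjunct2, THEN conjunct1, THEN bspec, THEN spec, THEN spec])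

lemma lie_scale_left: "v \<in> V \<Longrightarrow> lie R (r *\<^sub>R X) v = complex_of_real r *\<^sub>C lie R X v"
  by (rule lie_repD[THEN conjunct2, THEN conjunct2, THEN conjunct1, THEN bspec, THEN spec, THEN spec])

lemma lie_part: "X \<in> std_part p \<Longrightarrow> x \<in> part R q \<Longrightarrow> lie R X x \<in> part R (p + q)"
  by (rule lie_repD[THEN conjunct2, THEN conjunct2, THEN conjunct2, THEN conjunct1, THEN spec,
      THEN spec, THEN bspec, THEN subsetD, OF _ imageI])

lemma lie_lie:
  "X \<in> std_part p \<Longrightarrow> Y \<in> std_part q \<Longrightarrow> v \<in> V \<Longrightarrow> lie R (lie_bracket X Y) v =
    lie R X (lie R Y v) - (if p * q = 1 then - 1 else 1) *\<^sub>C lie R Y (lie R X v)"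
  by (rule lie_repD[THEN conjunct2, THEN conjunct2, THEN conjunct2, THEN conjunct2, THEN spec,
      THEN spec, THEN bspec, THEN bspec, THEN bspec])

lemma A_part: "x \<in> part R p \<Longrightarrow> A x \<in> part R p"
  and Z_part: "x \<in> part R p \<Longrightarrow> Z x \<in> part R (p + 1)"
  using lie_part[of lie_C 0 x p] lie_part[of lie_Z 1 x p]
  by (simp_all add: std_part_def lie_C_def lie_Z_def add.commute)

text \<open>The axioms state invariance only for homogeneous elements acting on homogeneous vectors,
  so both \<open>X\<close> and \<open>v\<close> are split first.\<close>

lemma lie_V: "v \<in> V \<Longrightarrow> lie R X v \<in> V"
proof (elim V_split[of _ 0])
  fix x y assume *: "x \<in> part R 0" "y \<in> part R (0 + 1)" "v = x + y"
  have X: "X = fst X *\<^sub>R lie_C + snd X *\<^sub>R lie_Z"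
    by (simp add: lie_C_def lie_Z_def)
  have "x \<in> V" "y \<in> V" "A x \<in> V" "A y \<in> V" "Z x \<in> V" "Z y \<in> V"
    using * part_subset A_part Z_part by blast+
  then show "lie R X v \<in> V"
    unfolding * by (subst X) (simp add: lie_add_left lie_scale_left V_closed linear_on_add[OF lie_linear])
qed

lemma lie_eq: "v \<in> V \<Longrightarrow> lie R X v = complex_of_real (fst X) *\<^sub>C A v + complex_of_real (snd X) *\<^sub>C Z v"
proof -
  assume "v \<in> V"
  then have "lie R (fst X *\<^sub>R lie_C + snd X *\<^sub>R lie_Z) v
      = complex_of_real (fst X) *\<^sub>C A v + complex_of_real (snd X) *\<^sub>C Z v"
    by (simp add: lie_add_left lie_scale_left)
  moreover have "fst X *\<^sub>R lie_C + snd X *\<^sub>R lie_Z = X"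
    by (simp add: lie_C_def lie_Z_def)
  ultimately show ?thesis by simp
qed

text \<open>For odd elements the bracket is an anticommutator, so \<open>[Z,Z] = -2C\<close> reads
  \<open>2 Z^2 = -2 A\<close>.\<close>

lemma Z_Z:
  assumes "v \<in> V"
  shows "Z (Z v) = - A v"
proof -
  have "lie R (lie_bracket lie_Z lie_Z) v = Z (Z v) + Z (Z v)"
    using lie_lie[of lie_Z 1 lie_Z 1, OF _ _ assms] by (simp add: std_part_def lie_Z_def scaleC_one)
  moreover have "lie_bracket lie_Z lie_Z = (- 2) *\<^sub>R lie_C"
    by (simp add: lie_bracket_def lie_Z_def lie_C_def)
  ultimately have "(- 2) *\<^sub>C A v = 2 *\<^sub>C Z (Z v)"
    using lie_scale_left[OF assms, of "- 2" lie_C] scaleC_add_left[of 1 1 "Z (Z v)"]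
    by (simp add: scaleC_one)
  then have "(1/2) *\<^sub>C (- 2) *\<^sub>C A v = (1/2) *\<^sub>C 2 *\<^sub>C Z (Z v)"
    by simp
  then show ?thesis
    by (simp add: scaleC_scaleC scaleC_one)
qed

lemma A_eq: "v \<in> V \<Longrightarrow> A v = - Z (Z v)"
  by (simp add: Z_Z)

lemma Z_A: "v \<in> V \<Longrightarrow> Z (A v) = A (Z v)"
  by (simp add: A_eq lie_V linear_on_minus[OF lie_linear V_subspace])

text \<open>Inherited from \<open>Z\<close>: the axioms state commutation with the circle only for
  \<open>Z\<close>, and \<open>A\<close> is minus its square.\<close>

lemma A_act: "t \<in> circle \<Longrightarrow> v \<in> V \<Longrightarrow> A (act R t v) = act R t (A v)"
  by (simp add: A_eq act_V lie_V Z_act linear_on_minus[OF act_linear V_subspace])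

section \<open>Differentiating the circle action through functionals\<close>

lemma derivative_at_zero:
  fixes f :: "'v \<Rightarrow> complex"
  assumes "v \<in> V" "Vector_Spaces.linear scaleC scaleC f"
  shows "((\<lambda>\<theta>. f (act R (cis \<theta>) v)) has_vector_derivative f (A v)) (at 0)"
  using differential assms unfolding differential_compatible_def by blast

text \<open>The group law moves the derivative at 0 to any angle: apply it to the vector
  \<open>act R (cis \<theta>) v\<close>, on which \<open>A\<close> commutes with the action. Both
  derivatives unfold to the same limit in the increment.\<close>

lemma derivative:
  fixes f :: "'v \<Rightarrow> complex"
  assumes "v \<in> V" "Vector_Spaces.linear scaleC scaleC f"
  shows "((\<lambda>\<theta>. f (act R (cis \<theta>) v)) has_vector_derivative f (act R (cis \<theta>) (A v))) (at \<theta>)"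
proof -
  have "((\<lambda>h. f (act R (cis h) (act R (cis \<theta>) v))) has_vector_derivative f (A (act R (cis \<theta>) v))) (at 0)"
    using assms act_V by (intro derivative_at_zero) auto
  then have "((\<lambda>h. f (act R (cis (\<theta> + h)) v)) has_vector_derivative f (act R (cis \<theta>) (A v))) (at 0)"
    using assms by (simp add: A_act act_mult[symmetric] cis_mult add.commute)
  then show ?thesis
    unfolding has_vector_derivative_def has_derivative_at by simp
qed

text \<open>Variation of constants, tested on a functional: multiplying by
  \<open>exp (- a * of_real \<theta>)\<close> removes the eigenvalue and leaves a function whose
  derivative is the constant \<open>f w\<close>.\<close>

lemma generalized_eigenvector_orbit:
  assumes "v \<in> V" "w \<in> V" "A v = a *\<^sub>C v + w" "A w = a *\<^sub>C w"
  shows "act R (cis \<theta>) v = exp (a * of_real \<theta>) *\<^sub>C (v + of_real \<theta> *\<^sub>C w)"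
proof (rule functionals_separate)
  fix f :: "'v \<Rightarrow> complex" assume f: "Vector_Spaces.linear scaleC scaleC f"
  note [simp] = complex_vector_pair.linear_add[OF f] complex_vector_pair.linear_scale[OF f]
  have E: "((\<lambda>\<theta>. exp (- a * of_real \<theta>)) has_vector_derivative - a * exp (- a * of_real \<theta>)) (at \<theta>)" for \<theta> :: real
  proof -
    have "((\<lambda>z. exp (- a * z)) has_field_derivative - a * exp (- a * of_real \<theta>)) (at (of_real \<theta>))"
      by (auto intro!: derivative_eq_intros)
    from has_vector_derivative_real_field[OF this] show ?thesis .
  qed
  \<comment> \<open>In the product rule the two terms with \<open>a\<close> cancel and only the
    defect \<open>x\<close> survives. It is used with \<open>u = w\<close>, \<open>x = 0\<close> and
    with \<open>u = v\<close>, \<open>x = w\<close>.\<close>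
  have D: "((\<lambda>\<theta>. exp (- a * of_real \<theta>) * f (act R (cis \<theta>) u)) has_vector_derivative
      exp (- a * of_real \<theta>) * f (act R (cis \<theta>) x)) (at \<theta>)"
    if "u \<in> V" "x \<in> V" "A u = a *\<^sub>C u + x" for u x \<theta>
    using has_vector_derivative_mult[OF E derivative[OF that(1) f]] that
    by (simp add: V_closed linear_on_add[OF act_linear] linear_on_scale[OF act_linear] algebra_simps)
  have const: "g s = g 0" if "\<And>x. (g has_vector_derivative 0) (at x)" for g :: "real \<Rightarrow> complex" and s
    using has_vector_derivative_zero_constant[of UNIV g] that by (metis UNIV_I convex_UNIV)
  have one: "act R (cis 0) u = u" if "u \<in> V" for u
    using act_one[OF that] by (simp add: cis_zero)
  have "act R (cis s) 0 = 0" for s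
    using linear_on_zero[OF act_linear V_subspace] by simp
  then have "exp (- a * of_real s) * f (act R (cis s) w) = f w" for s
    using const[of "\<lambda>\<theta>. exp (- a * of_real \<theta>) * f (act R (cis \<theta>) w)" s] D[of w 0] assms V_closed(1)
      complex_vector_pair.linear_0[OF f] one[OF assms(2)] by simp
  then have "((\<lambda>\<theta>. exp (- a * of_real \<theta>) * f (act R (cis \<theta>) v)) has_vector_derivative f w) (at \<theta>)" for \<theta>
    using D[OF assms(1-3)] by simp
  moreover have "((\<lambda>\<theta>. of_real \<theta> * f w) has_vector_derivative f w) (at \<theta>)" for \<theta>
    using has_vector_derivative_mult_left[OF has_vector_derivative_of_real[OF DERIV_ident], of "f w"] by simp
  ultimately have "((\<lambda>\<theta>. exp (- a * of_real \<theta>) * f (act R (cis \<theta>) v) - of_real \<theta> * f w) has_vector_derivative 0) (at \<theta>)" for \<theta>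
    using has_vector_derivative_diff by fastforce
  from const[OF this, of \<theta>] have "exp (- a * of_real \<theta>) * f (act R (cis \<theta>) v) - of_real \<theta> * f w = f v"
    using one[OF assms(1)] by simp
  then have "exp (a * of_real \<theta>) * (exp (- a * of_real \<theta>) * f (act R (cis \<theta>) v)) = exp (a * of_real \<theta>) * (f v + of_real \<theta> * f w)"
    by (simp add: algebra_simps)
  then show "f (act R (cis \<theta>) v) = f (exp (a * of_real \<theta>) *\<^sub>C (v + of_real \<theta> *\<^sub>C w))"
    by (simp add: mult.assoc[symmetric] exp_add[symmetric])
qed

lemma eigenvector_orbit:
  assumes "v \<in> V" "A v = a *\<^sub>C v"
  shows "act R (cis \<theta>) v = exp (a * of_real \<theta>) *\<^sub>C v"
  using generalized_eigenvector_orbit[OF assms(1) V_closed(1)] assms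
    linear_on_zero[OF lie_linear V_subspace] by simp

text \<open>The angle \<open>2 * pi\<close> acts as the identity, so
  \<open>exp (2 * pi * a) = 1\<close>, which leaves only integer multiples of the imaginary
  unit.\<close>

lemma eigenvalue_integral:
  assumes "v \<in> V" "A v = a *\<^sub>C v" "v \<noteq> 0"
  obtains m :: int where "a = \<i> * of_int m"
proof -
  have "exp (a * of_real (2 * pi)) *\<^sub>C v = 1 *\<^sub>C v"
    using eigenvector_orbit[OF assms(1,2), of "2 * pi"] assms by (simp add: act_one scaleC_one)
  then have "exp (a * of_real (2 * pi)) = 1"
    using assms(3) by (subst (asm) complex_vector.scale_cancel_right) simp
  then obtain n :: int where "Re a = 0" "Im a = of_int n"
    unfolding exp_eq_1 by auto
  then have "a = \<i> * of_int n"
    by (simp add: complex_eq_iff)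
  then show thesis by (rule that)
qed

text \<open>A Jordan block would make \<open>\<theta> \<mapsto> \<pi>(e\<^sup>i\<^sup>\<theta>) v\<close> grow linearly, contradicting its periodicity.\<close>

lemma A_semisimple:
  assumes "v \<in> V" "A (A v - a *\<^sub>C v) = a *\<^sub>C (A v - a *\<^sub>C v)"
  shows "A v = a *\<^sub>C v"
proof (rule ccontr)
  let ?w = "A v - a *\<^sub>C v" and ?e = "exp (a * of_real (2 * pi))"
  assume "A v \<noteq> a *\<^sub>C v"
  then have w: "?w \<in> V" "?w \<noteq> 0"
    using assms by (auto simp: V_closed lie_V)
  obtain m :: int where "a = \<i> * of_int m"
    using eigenvalue_integral[OF w(1) assms(2) w(2)] .
  then have "?e = 1"
    by (auto simp: exp_eq_1)
  moreover have "v = ?e *\<^sub>C (v + of_real (2 * pi) *\<^sub>C ?w)"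
    using generalized_eigenvector_orbit[OF assms(1) w(1) _ assms(2), of "2 * pi"] assms(1)
    by (simp add: act_one)
  ultimately have "of_real (2 * pi) *\<^sub>C ?w = 0"
    by (simp add: scaleC_one)
  with w show False by simp
qed

text \<open>Differentiating \<open>t powi m\<close> at 1, through functionals, gives one inclusion,
  and the explicit orbit of an eigenvector gives the other. From here on weights can be treated
  through \<open>A\<close> alone.\<close>

lemma weight_space_eq: "weight_space R m = {v \<in> V. A v = (\<i> * of_int m) *\<^sub>C v}"
proof (intro set_eqI iffI)
  fix v assume "v \<in> weight_space R m"
  then have v: "v \<in> V" "\<And>t. t \<in> circle \<Longrightarrow> act R t v = (t powi m) *\<^sub>C v"
    by (auto simp: weight_space_def)
  have "A v = (\<i> * of_int m) *\<^sub>C v"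
  proof (rule functionals_separate)
    fix f :: "'v \<Rightarrow> complex" assume f: "Vector_Spaces.linear scaleC scaleC f"
    have "((\<lambda>\<theta>. exp (\<i> * of_int m * of_real \<theta>) * f v) has_vector_derivative f (A v)) (at 0)"
      using derivative_at_zero[OF v(1) f]
      by (simp add: v(2) cis_power_int complex_vector_pair.linear_scale[OF f])
        (simp add: cis_conv_exp mult_ac)
    moreover have "((\<lambda>\<theta>. exp (\<i> * of_int m * of_real \<theta>) * f v) has_vector_derivative \<i> * of_int m * f v) (at 0)"
    proof -
      have "((\<lambda>z. exp (\<i> * of_int m * z) * f v) has_field_derivative \<i> * of_int m * f v) (at (of_real 0))"
        by (auto intro!: derivative_eq_intros)
      from has_vector_derivative_real_field[OF this] show ?thesis .
    qed
    ultimately show "f (A v) = f ((\<i> * of_int m) *\<^sub>C v)"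
      by (simp add: vector_derivative_unique_at complex_vector_pair.linear_scale[OF f])
  qed
  with v show "v \<in> {v \<in> V. A v = (\<i> * of_int m) *\<^sub>C v}"
    by simp
next
  fix v assume "v \<in> {v \<in> V. A v = (\<i> * of_int m) *\<^sub>C v}"
  then have v: "v \<in> V" "A v = (\<i> * of_int m) *\<^sub>C v"
    by auto
  have "act R t v = (t powi m) *\<^sub>C v" if t: "t \<in> circle" for t
  proof -
    obtain \<theta> where "t = cis \<theta>"
      using t unfolding in_circle_iff_cis by blast
    then show ?thesis
      using eigenvector_orbit[OF v, of \<theta>] by (simp add: cis_power_int)
        (simp add: cis_conv_exp mult_ac)
  qed
  with v(1) show "v \<in> weight_space R m"
    by (simp add: weight_space_def)
qed

section \<open>Finite-dimensional orbits and generation by weight vectors\<close>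

lemma orbit_bounded:
  fixes f :: "'v \<Rightarrow> complex"
  assumes "v \<in> V" "Vector_Spaces.linear scaleC scaleC f"
  shows "bounded ((\<lambda>t. f (act R t v)) ` circle)"
proof -
  have "(\<lambda>t. f (act R t v)) ` circle = (\<lambda>\<theta>. f (act R (cis \<theta>) v)) ` {- pi..pi}"
    using in_circle_iff_cis by (auto simp: image_iff)
  moreover have "continuous_on {- pi..pi} (\<lambda>\<theta>. f (act R (cis \<theta>) v))"
    using derivative[OF assms] has_vector_derivative_continuous
    by (intro continuous_at_imp_continuous_on) blast
  ultimately show ?thesis
    by (simp add: compact_continuous_image compact_imp_bounded)
qed

lemma orbit_finite_dim:
  assumes "v \<in> V"
  obtains B where "finite B" "\<And>t. t \<in> circle \<Longrightarrow> act R t v \<in> complex_vector.span B"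
proof -
  let ?O = "(\<lambda>t. act R t v) ` circle"
  obtain B where B: "B \<subseteq> ?O" "complex_vector.independent B" "?O \<subseteq> complex_vector.span B"
    using complex_vector.maximal_independent_subset by blast
  have "finite B"
  proof (rule ccontr)
    assume "infinite B"
    then obtain e :: "nat \<Rightarrow> 'v" where e: "inj e" "range e \<subseteq> B"
      using infinite_countable_subset by blast
    \<comment> \<open>On an independent set any values may be prescribed. These give
      \<open>f (e n) = n\<close>; outside the range of \<open>e\<close> the value of
      \<open>inv e\<close> is arbitrary and harmless.\<close>
    obtain f :: "'v \<Rightarrow> complex" where f: "Vector_Spaces.linear scaleC scaleC f"
      "\<forall>x\<in>B. f x = of_nat (inv e x)"
      using complex_vector_pair.linear_independent_extend[OF B(2), of "\<lambda>x. of_nat (inv e x)"] by (elim exE conjE)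
    obtain M where M: "\<And>t. t \<in> circle \<Longrightarrow> norm (f (act R t v)) \<le> M"
      using orbit_bounded[OF assms f(1)] unfolding bounded_iff by blast
    have "norm (f (e n)) \<le> M" for n
      using M e(2) B(1) by (metis (no_types, lifting) image_iff range_subsetD subsetD)
    then have "real n \<le> M" for n
      using f(2) e by (metis inv_f_f norm_of_nat range_subsetD)
    then show False
      by (meson not_le reals_Archimedean2)
  qed
  with B(3) show thesis
    by (intro that) auto
qed

text \<open>A derivative cannot leave the span: otherwise a functional vanishing on the span, with
  value 1 at the derivative, would give the zero function derivative 1. The whole orbit of an
  iterate is carried along because the next step differentiates along it.\<close>

lemma A_iterate_in_span:
  assumes "\<And>t. t \<in> circle \<Longrightarrow> act R t v \<in> complex_vector.span B" "v \<in> V"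
  shows "(A ^^ n) v \<in> V \<and> (\<forall>t\<in>circle. act R t ((A ^^ n) v) \<in> complex_vector.span B)"
proof (induction n)
  case (Suc n)
  let ?w = "(A ^^ n) v"
  have "act R t (A ?w) \<in> complex_vector.span B" if t: "t \<in> circle" for t
  proof (rule ccontr)
    assume "act R t (A ?w) \<notin> complex_vector.span B"
    then obtain f :: "'v \<Rightarrow> complex" where f: "Vector_Spaces.linear scaleC scaleC f"
      "\<And>y. y \<in> complex_vector.span B \<Longrightarrow> f y = 0" "f (A (act R t ?w)) = 1"
      using Suc A_act[OF t] separating_functional by metis
    have "act R t ?w \<in> V"
      using Suc t act_V by simp
    from derivative_at_zero[OF this f(1)]
    have "((\<lambda>\<theta>. f (act R (cis \<theta> * t) ?w)) has_vector_derivative 1) (at 0)"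
      using Suc t f(3) by (simp add: act_mult)
    moreover have "f (act R (cis \<theta> * t) ?w) = 0" for \<theta>
      using Suc t by (intro f(2)) (simp add: norm_mult)
    ultimately have "((\<lambda>\<theta>::real. 0) has_vector_derivative (1::complex)) (at 0)"
      by simp
    then show False
      using vector_derivative_unique_at[OF _ has_vector_derivative_const] by force
  qed
  with Suc show ?case
    by (simp add: lie_V)
qed (use assms in simp)

lemma in_span_weight_vectors:
  assumes "v \<in> V"
  shows "v \<in> complex_vector.span (\<Union>m. weight_space R m)"
proof -
  obtain B where B: "finite B" "\<And>t. t \<in> circle \<Longrightarrow> act R t v \<in> complex_vector.span B"
    using orbit_finite_dim[OF assms] by blast
  have "(A ^^ n) v \<in> complex_vector.span B" for n
  proof -
    have "(A ^^ n) v \<in> V" "\<forall>t\<in>circle. act R t ((A ^^ n) v) \<in> complex_vector.span B"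
      using A_iterate_in_span[of v B n] B(2) assms by blast+
    then show ?thesis
      using act_one by (metis cis_in_circle cis_zero)
  qed
  then obtain p where "p \<noteq> 0" "poly_op A p v = 0"
    using annihilating_poly_exists[OF B(1)] by blast
  then have v: "v \<in> complex_vector.span {w \<in> V. \<exists>a. A w = a *\<^sub>C w}"
    using assms A_semisimple
    by (intro annihilated_imp_in_span_eigenvectors[OF V_subspace lie_linear]) (auto intro!: lie_V)
  have "{w \<in> V. \<exists>a. A w = a *\<^sub>C w} \<subseteq> complex_vector.span (\<Union>m. weight_space R m)"
  proof
    fix w assume "w \<in> {w \<in> V. \<exists>a. A w = a *\<^sub>C w}"
    then obtain a where w: "w \<in> V" "A w = a *\<^sub>C w"
      by blast
    show "w \<in> complex_vector.span (\<Union>m. weight_space R m)"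
    proof (cases "w = 0")
      case False
      obtain m :: int where "a = \<i> * of_int m"
        using eigenvalue_integral[OF w False] .
      then have "w \<in> (\<Union>m. weight_space R m)"
        using w by (auto simp: weight_space_eq)
      then show ?thesis
        by (rule complex_vector.span_base)
    qed (simp add: complex_vector.span_zero)
  qed
  from complex_vector.span_minimal[OF this complex_vector.subspace_span] show ?thesis
    using v by (rule subsetD)
qed

text \<open>Semisimplicity at eigenvalue 0. It separates weight zero, the kernel of
  \<open>A\<close>, from all nonzero weights, which lie in its range.\<close>

lemma kernel_range_A_disjoint:
  assumes "v \<in> V" "A (A v) = 0"
  shows "A v = 0"
  using A_semisimple[of v 0] assms by simp

end

section \<open>Intertwiners\<close>

text \<open>Neither side is required to satisfy the axioms of a representation, so that maps out of
  a model can be studied before the model is known to be one.\<close>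

definition rep_hom ::
  "'w::complex_vector super_rep \<Rightarrow> 'v::complex_vector super_rep \<Rightarrow> ('w \<Rightarrow> 'v) \<Rightarrow> bool"
  where "rep_hom T R \<phi> \<longleftrightarrow> linear_on (space_of T) \<phi> \<and> (\<forall>p. \<phi> ` part T p \<subseteq> part R p) \<and>
    (\<forall>t\<in>circle. \<forall>v\<in>space_of T. \<phi> (act T t v) = act R t (\<phi> v)) \<and>
    (\<forall>X. \<forall>v\<in>space_of T. \<phi> (lie T X v) = lie R X (\<phi> v))"

text \<open>The closure conditions under which the axioms of a representation can be pulled back along an
  injective intertwiner.\<close>

definition stable_rep :: "'w::complex_vector super_rep \<Rightarrow> bool"
  where "stable_rep T \<longleftrightarrow> (\<forall>p. complex_vector.subspace (part T p)) \<and>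
    (\<forall>t\<in>circle. \<forall>p. act T t ` part T p \<subseteq> part T p) \<and>
    (\<forall>t\<in>circle. act T t ` space_of T \<subseteq> space_of T) \<and>
    (\<forall>p q. \<forall>X\<in>std_part p. lie T X ` part T q \<subseteq> part T (p + q)) \<and>
    (\<forall>X. lie T X ` space_of T \<subseteq> space_of T)"

context
  fixes T :: "'w::complex_vector super_rep"
  assumes st: "stable_rep T"
begin

lemma stable_subspace: "complex_vector.subspace (part T p)"
  and stable_act_part: "t \<in> circle \<Longrightarrow> v \<in> part T p \<Longrightarrow> act T t v \<in> part T p"
  and stable_act: "t \<in> circle \<Longrightarrow> v \<in> space_of T \<Longrightarrow> act T t v \<in> space_of T"
  and stable_lie_part: "X \<in> std_part q \<Longrightarrow> v \<in> part T p \<Longrightarrow> lie T X v \<in> part T (q + p)"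
  and stable_lie: "v \<in> space_of T \<Longrightarrow> lie T X v \<in> space_of T"
  using st by (simp_all only: stable_rep_def image_subset_iff)

lemma stable_part_subset: "part T p \<subseteq> space_of T"
  by (rule part_subset_space_of) (rule stable_subspace)

lemma stable_space_subspace: "complex_vector.subspace (space_of T)"
  by (rule subspace_space_of) (rule stable_subspace)

end

context
  fixes T :: "'w::complex_vector super_rep" and R :: "'v::complex_vector super_rep" and \<phi>
  assumes hom: "rep_hom T R \<phi>"
begin

lemma hom_linear: "linear_on (space_of T) \<phi>"
  and hom_part: "v \<in> part T p \<Longrightarrow> \<phi> v \<in> part R p"
  and hom_act: "t \<in> circle \<Longrightarrow> v \<in> space_of T \<Longrightarrow> \<phi> (act T t v) = act R t (\<phi> v)"
  and hom_lie: "v \<in> space_of T \<Longrightarrow> \<phi> (lie T X v) = lie R X (\<phi> v)"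
  using hom by (simp_all only: rep_hom_def image_subset_iff)

lemma hom_space:
  assumes "stable_rep T" "v \<in> space_of T"
  shows "\<phi> v \<in> space_of R"
proof -
  obtain x y where *: "x \<in> part T 0" "y \<in> part T 1" "v = x + y"
    using assms(2) by (auto simp: space_of_def)
  then have "x \<in> space_of T" "y \<in> space_of T"
    using stable_part_subset[OF assms(1)] by blast+
  then have "\<phi> v = \<phi> x + \<phi> y"
    by (simp add: *(3) linear_on_add[OF hom_linear])
  then show ?thesis
    using * hom_part unfolding space_of_def by blast
qed

end

text \<open>By injectivity an identity in \<open>T\<close> may be checked after applying
  \<open>\<psi>\<close>, where it is the corresponding axiom of \<open>R\<close>. Only the
  derivative condition needs more, since its functionals live on the source of
  \<open>\<psi>\<close>.\<close>

lemma supercircle_rep_of_embedding: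
  fixes T :: "'w::complex_vector super_rep" and R :: "'v::complex_vector super_rep"
  assumes R: "supercircle_rep R" and st: "stable_rep T" and hom: "rep_hom T R \<psi>"
    and inj: "inj_on \<psi> (space_of T)"
  shows "supercircle_rep T"
proof -
  interpret supercircle R by standard fact
  let ?S = "space_of T"
  note sub = stable_space_subspace[OF st]
  note closed = complex_vector.subspace_0[OF sub] complex_vector.subspace_add[OF sub]
    complex_vector.subspace_scale[OF sub] complex_vector.subspace_diff[OF sub]
    stable_act[OF st] stable_lie[OF st]
  note lin = linear_on_add[OF hom_linear[OF hom]] linear_on_scale[OF hom_linear[OF hom]]
    linear_on_diff[OF hom_linear[OF hom] sub] linear_on_zero[OF hom_linear[OF hom] sub]
    hom_act[OF hom] hom_lie[OF hom]
  note \<psi>V = hom_space[OF hom st]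
  have eqI: "x = y" if "\<psi> x = \<psi> y" "x \<in> ?S" "y \<in> ?S" for x y
    using inj that by (auto simp: inj_on_def)
  have act_lin: "linear_on ?S (act T t)" if t: "t \<in> circle" for t
  proof (rule linear_onI)
    fix x y assume "x \<in> ?S" "y \<in> ?S"
    then show "act T t (x + y) = act T t x + act T t y"
      using t by (intro eqI) (simp_all only: closed lin \<psi>V linear_on_add[OF act_linear])
  next
    fix c x assume "x \<in> ?S"
    then show "act T t (c *\<^sub>C x) = c *\<^sub>C act T t x"
      using t by (intro eqI) (simp_all only: closed lin \<psi>V linear_on_scale[OF act_linear])
  qed
  have lie_lin: "linear_on ?S (lie T X)" for X
  proof (rule linear_onI)
    fix x y assume "x \<in> ?S" "y \<in> ?S"
    then show "lie T X (x + y) = lie T X x + lie T X y"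
      by (intro eqI) (simp_all only: closed lin \<psi>V linear_on_add[OF lie_linear])
  next
    fix c x assume "x \<in> ?S"
    then show "lie T X (c *\<^sub>C x) = c *\<^sub>C lie T X x"
      by (intro eqI) (simp_all only: closed lin \<psi>V linear_on_scale[OF lie_linear])
  qed
  have "super_space T"
  proof -
    have "x = 0" if x: "x \<in> part T 0" "x \<in> part T 1" for x
    proof (rule eqI)
      show "\<psi> x = \<psi> 0"
        using parts_disjoint[of "\<psi> x" 0] hom_part[OF hom x(1)] hom_part[OF hom x(2)] by (simp add: lin)
    qed (use x stable_part_subset[OF st] closed in auto)
    then show ?thesis
      using stable_subspace[OF st] complex_vector.subspace_0[OF stable_subspace[OF st]]
      unfolding super_space_def by blast
  qed
  moreover have "circle_rep T"
    unfolding circle_rep_def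
  proof (intro conjI ballI allI)
    fix v assume v: "v \<in> ?S"
    then show "act T 1 v = v"
      by (intro eqI) (simp_all add: closed lin \<psi>V act_one)
    fix s t :: complex assume "s \<in> circle" "t \<in> circle"
    with v show "act T (s * t) v = act T s (act T t v)"
      by (intro eqI) (simp_all add: closed lin \<psi>V act_mult norm_mult)
  qed (use act_lin stable_act_part[OF st] in auto)
  moreover have "lie_rep T"
    unfolding lie_rep_def
  proof (intro conjI ballI allI)
    fix v X Y and r :: real assume v: "v \<in> ?S"
    then show "lie T (X + Y) v = lie T X v + lie T Y v"
      by (intro eqI) (simp_all only: closed lin \<psi>V lie_add_left)
    show "lie T (r *\<^sub>R X) v = complex_of_real r *\<^sub>C lie T X v"
      using v by (intro eqI) (simp_all only: closed lin \<psi>V lie_scale_left)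
  next
    fix p q v and X Y :: "real \<times> real" assume *: "X \<in> std_part p" "Y \<in> std_part q" "v \<in> ?S"
    let ?c = "if p * q = 1 then - 1 else 1 :: complex"
    have "\<psi> (lie T (lie_bracket X Y) v) = \<psi> (lie T X (lie T Y v) - ?c *\<^sub>C lie T Y (lie T X v))"
      using * lie_lie[OF *(1,2), of "\<psi> v"] by (simp only: closed lin \<psi>V)
    then show "lie T (lie_bracket X Y) v = lie T X (lie T Y v) - ?c *\<^sub>C lie T Y (lie T X v)"
      using * by (intro eqI) (simp_all only: closed)
  qed (use lie_lin stable_lie_part[OF st] in \<open>blast+\<close>)
  moreover have "differential_compatible T"
    unfolding differential_compatible_def
  proof (intro ballI allI impI)
    fix v and f :: "'w \<Rightarrow> complex"
    assume v: "v \<in> ?S" and f: "Vector_Spaces.linear scaleC scaleC f"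
    \<comment> \<open>\<open>f\<close> is transported to the image of \<open>\<psi>\<close>, where
      it is linear, and then extended to all of the target type so that the derivative condition of
      \<open>R\<close> applies to it.\<close>
    let ?g = "\<lambda>x. f (inv_into ?S \<psi> x)"
    have inv: "?g (\<psi> x) = f x" if "x \<in> ?S" for x
      using inj that by simp
    have "linear_on (\<psi> ` ?S) ?g"
    proof (rule linear_onI)
      fix x y assume "x \<in> \<psi> ` ?S" "y \<in> \<psi> ` ?S"
      then obtain x' y' where *: "x' \<in> ?S" "x = \<psi> x'" "y' \<in> ?S" "y = \<psi> y'"
        by blast
      then show "?g (x + y) = ?g x + ?g y"
        using inv[of "x' + y'"] inv[of x'] inv[of y']
        by (simp add: closed lin complex_vector_pair.linear_add[OF f])
    next
      fix c x assume "x \<in> \<psi> ` ?S"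
      then obtain x' where *: "x' \<in> ?S" "x = \<psi> x'"
        by blast
      then show "?g (c *\<^sub>C x) = c *\<^sub>C ?g x"
        using inv[of "c *\<^sub>C x'"] inv[of x']
        by (simp add: closed lin complex_vector_pair.linear_scale[OF f])
    qed
    then obtain g :: "'v \<Rightarrow> complex" where g: "Vector_Spaces.linear scaleC scaleC g"
      "\<And>x. x \<in> \<psi> ` ?S \<Longrightarrow> g x = ?g x"
      using linear_on_extend linear_on_image_subspace[OF hom_linear[OF hom] sub] by blast
    have g\<psi>: "g (\<psi> x) = f x" if "x \<in> ?S" for x
      using g(2) inv that by simp
    have "g (act R (cis \<theta>) (\<psi> v)) = f (act T (cis \<theta>) v)" for \<theta>
      using g\<psi>[OF stable_act[OF st _ v], of "cis \<theta>"] v by (simp add: hom_act[OF hom])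
    moreover have "g (A (\<psi> v)) = f (lie T lie_C v)"
      using g\<psi>[OF stable_lie[OF st v], of lie_C] v by (simp add: hom_lie[OF hom])
    ultimately show "((\<lambda>\<theta>. f (act T (cis \<theta>) v)) has_vector_derivative f (lie T lie_C v)) (at 0)"
      using derivative_at_zero[OF \<psi>V[OF v] g(1)] by simp
  qed
  moreover have "lie T lie_Z (act T t v) = act T t (lie T lie_Z v)" if "t \<in> circle" "v \<in> ?S" for t v
    using that by (intro eqI) (simp_all only: closed lin \<psi>V Z_act)
  ultimately show ?thesis
    unfolding supercircle_rep_def by blast
qed

text \<open>The map required by \<open>rep_isomorphic\<close> goes the other way, hence the inverse
  of \<open>\<psi>\<close>. It respects parity because a preimage of a homogeneous vector may be
  replaced by its component of that parity.\<close>

lemma rep_isomorphicI: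
  fixes T :: "'w::complex_vector super_rep" and R :: "'v::complex_vector super_rep"
  assumes R: "supercircle_rep R" and st: "stable_rep T" and hom: "rep_hom T R \<psi>"
    and bij: "bij_betw \<psi> (space_of T) (space_of R)"
  shows "rep_isomorphic R T"
proof -
  interpret supercircle R by standard fact
  let ?S = "space_of T"
  note sub = stable_space_subspace[OF st]
  note closed = complex_vector.subspace_add[OF sub] complex_vector.subspace_scale[OF sub]
    stable_act[OF st] stable_lie[OF st]
  have inj: "inj_on \<psi> ?S" and surj: "\<psi> ` ?S = V"
    using bij by (auto simp: bij_betw_def)
  define \<phi> where "\<phi> = inv_into ?S \<psi>"
  have \<phi>\<psi>: "\<phi> (\<psi> x) = x" if "x \<in> ?S" for x
    using inj that by (simp add: \<phi>_def)
  have lift: "\<exists>x\<in>?S. v = \<psi> x" if "v \<in> V" for v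
    using surj that by blast
  have image_part: "part R p = \<psi> ` part T p" for p
  proof
    show "part R p \<subseteq> \<psi> ` part T p"
    proof
      fix v assume v: "v \<in> part R p"
      then obtain x where x: "x \<in> ?S" "v = \<psi> x"
        using lift part_subset by blast
      obtain y z where yz: "y \<in> part T p" "z \<in> part T (p + 1)" "x = y + z"
      proof -
        obtain y z where *: "y \<in> part T 0" "z \<in> part T 1" "x = y + z"
          using x by (auto simp: space_of_def)
        show thesis
          using that[of y z] that[of z y] * by (cases p) (simp_all add: add.commute)
      qed
      then have "\<psi> x = \<psi> y + \<psi> z"
        using linear_on_add[OF hom_linear[OF hom]] stable_part_subset[OF st] by blast
      \<comment> \<open>Compares \<open>v + 0\<close> with \<open>\<psi> y + \<psi> z\<close>; the
        component of the wrong parity is mapped to 0.\<close>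
      then have "v = \<psi> y"
        using split_eq(1)[of v p "\<psi> y" 0 "\<psi> z"] v x yz hom_part[OF hom] part_closed(1) by simp
      with yz show "v \<in> \<psi> ` part T p" by blast
    qed
  qed (use hom_part[OF hom] in blast)
  have "bij_betw \<phi> V ?S"
    unfolding \<phi>_def using bij by (rule bij_betw_inv_into)
  moreover have "linear_on V \<phi>"
  proof (rule linear_onI)
    fix x y assume "x \<in> V" "y \<in> V"
    then obtain x' y' where *: "x' \<in> ?S" "x = \<psi> x'" "y' \<in> ?S" "y = \<psi> y'"
      using lift by meson
    then show "\<phi> (x + y) = \<phi> x + \<phi> y"
      using \<phi>\<psi>[of "x' + y'"] by (simp add: \<phi>\<psi> closed linear_on_add[OF hom_linear[OF hom]])
  next
    fix c x assume "x \<in> V"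
    then obtain x' where *: "x' \<in> ?S" "x = \<psi> x'"
      using lift by meson
    then show "\<phi> (c *\<^sub>C x) = c *\<^sub>C \<phi> x"
      using \<phi>\<psi>[of "c *\<^sub>C x'"] by (simp add: \<phi>\<psi> closed linear_on_scale[OF hom_linear[OF hom]])
  qed
  moreover have "\<phi> ` part R p = part T p" for p
  proof -
    have "\<phi> ` \<psi> ` part T p = (\<lambda>x. x) ` part T p"
      unfolding image_image using stable_part_subset[OF st, of p] \<phi>\<psi> by (intro image_cong) auto
    then show ?thesis
      by (simp add: image_part)
  qed
  moreover have "\<phi> (act R t v) = act T t (\<phi> v)" if t: "t \<in> circle" and v: "v \<in> V" for t v
  proof -
    obtain x where x: "x \<in> ?S" "v = \<psi> x" using lift[OF v] by blast
    then show ?thesis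
      using \<phi>\<psi>[OF stable_act[OF st t x(1)]] hom_act[OF hom t x(1)] \<phi>\<psi> by simp
  qed
  moreover have "\<phi> (lie R X v) = lie T X (\<phi> v)" if v: "v \<in> V" for X v
  proof -
    obtain x where x: "x \<in> ?S" "v = \<psi> x" using lift[OF v] by blast
    then show ?thesis
      using \<phi>\<psi>[OF stable_lie[OF st x(1)], of X] hom_lie[OF hom x(1), of X] \<phi>\<psi> by simp
  qed
  ultimately show ?thesis
    unfolding rep_isomorphic_def using R supercircle_rep_of_embedding[OF R st hom inj] by blast
qed

lemma rep_isomorphic_refl: "supercircle_rep R \<Longrightarrow> rep_isomorphic R R"
  unfolding rep_isomorphic_def
  by (intro conjI exI[of _ id]) (auto simp: linear_on_def)

section \<open>Direct sums\<close>

lemma space_of_rep_plus: "space_of (T \<oplus>\<^sub>R T') = space_of T \<times> space_of T'"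
proof
  show "space_of (T \<oplus>\<^sub>R T') \<subseteq> space_of T \<times> space_of T'"
    by (force simp: space_of_def rep_plus_def)
  show "space_of T \<times> space_of T' \<subseteq> space_of (T \<oplus>\<^sub>R T')"
    by (force simp: space_of_def rep_plus_def)
qed

lemma rep_plus_simps:
  "part (T \<oplus>\<^sub>R T') p = part T p \<times> part T' p"
  "act (T \<oplus>\<^sub>R T') t = map_prod (act T t) (act T' t)"
  "lie (T \<oplus>\<^sub>R T') X = map_prod (lie T X) (lie T' X)"
  by (simp_all add: rep_plus_def)

lemma stable_rep_plus:
  assumes "stable_rep T" "stable_rep T'"
  shows "stable_rep (T \<oplus>\<^sub>R T')"
  unfolding stable_rep_def rep_plus_simps space_of_rep_plus
proof (intro conjI allI ballI)
  show "complex_vector.subspace (part T p \<times> part T' p)" for p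
    using stable_subspace[OF assms(1), of p] stable_subspace[OF assms(2), of p]
    by (auto simp: complex_vector.subspace_def zero_prod_def scaleC_prod_def)
qed (use assms in \<open>auto simp: stable_act_part stable_act stable_lie_part stable_lie\<close>)

lemma rep_hom_rep_plus:
  assumes R: "supercircle_rep R" and st: "stable_rep T" "stable_rep T'"
    and hom: "rep_hom T R \<phi>" "rep_hom T' R \<phi>'"
  shows "rep_hom (T \<oplus>\<^sub>R T') R (\<lambda>x. \<phi> (fst x) + \<phi>' (snd x))"
proof -
  interpret supercircle R by standard fact
  show ?thesis
    unfolding rep_hom_def rep_plus_simps space_of_rep_plus
    by (intro conjI allI ballI linear_onI)
      (auto simp: linear_on_add[OF hom_linear[OF hom(1)]] linear_on_add[OF hom_linear[OF hom(2)]]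
        linear_on_scale[OF hom_linear[OF hom(1)]] linear_on_scale[OF hom_linear[OF hom(2)]]
        scaleC_prod_def scaleC_add_right hom_part[OF hom(1)] hom_part[OF hom(2)]
        hom_act[OF hom(1)] hom_act[OF hom(2)] hom_lie[OF hom(1)] hom_lie[OF hom(2)]
        hom_space[OF hom(1) st(1)] hom_space[OF hom(2) st(2)]
        linear_on_add[OF act_linear] linear_on_add[OF lie_linear] part_closed)
qed

lemma rep_Sum_simps:
  "part (rep_Sum I S) p = {f. finite {i. f i \<noteq> 0} \<and> (\<forall>i\<in>I. f i \<in> part (S i) p) \<and> (\<forall>i. i \<notin> I \<longrightarrow> f i = 0)}"
  "act (rep_Sum I S) t f = (\<lambda>i. if i \<in> I then act (S i) t (f i) else 0)"
  "lie (rep_Sum I S) X f = (\<lambda>i. if i \<in> I then lie (S i) X (f i) else 0)"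
  by (simp_all add: rep_Sum_def fun_eq_iff)

lemma space_of_rep_Sum:
  assumes "\<And>i. i \<in> I \<Longrightarrow> stable_rep (S i)"
  shows "space_of (rep_Sum I S) =
    {f. finite {i. f i \<noteq> 0} \<and> (\<forall>i\<in>I. f i \<in> space_of (S i)) \<and> (\<forall>i. i \<notin> I \<longrightarrow> f i = 0)}"
    (is "_ = ?S")
proof (intro set_eqI iffI)
  fix f assume "f \<in> space_of (rep_Sum I S)"
  then obtain x y where *: "x \<in> part (rep_Sum I S) 0" "y \<in> part (rep_Sum I S) 1" "f = x + y"
    by (auto simp: space_of_def)
  have "{i. f i \<noteq> 0} \<subseteq> {i. x i \<noteq> 0} \<union> {i. y i \<noteq> 0}"
    using * by auto
  then have "finite {i. f i \<noteq> 0}"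
    using * by (auto simp: rep_Sum_simps intro: finite_subset)
  moreover have "f i \<in> space_of (S i)" if "i \<in> I" for i
    using * that unfolding space_of_def
    by (intro CollectI exI[of _ "x i"] exI[of _ "y i"]) (simp add: rep_Sum_simps)
  ultimately show "f \<in> ?S"
    using * by (auto simp: rep_Sum_simps)
next
  fix f assume f: "f \<in> ?S"
  \<comment> \<open>The last conjunct makes the chosen components vanish wherever \<open>f\<close>
    does; without it their supports might be infinite.\<close>
  have "\<exists>x y. x \<in> part (S i) 0 \<and> y \<in> part (S i) 1 \<and> f i = x + y \<and> (f i = 0 \<longrightarrow> x = 0 \<and> y = 0)"
    if "i \<in> I" for i
  proof (cases "f i = 0")
    case True
    then show ?thesis
      using stable_subspace[OF assms[OF that]] by (auto simp: complex_vector.subspace_0)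
  next
    case False
    have "f i \<in> space_of (S i)"
      using f that by simp
    with False show ?thesis
      unfolding space_of_def by blast
  qed
  then obtain x y where *: "\<And>i. i \<in> I \<Longrightarrow> x i \<in> part (S i) 0 \<and> y i \<in> part (S i) 1 \<and> f i = x i + y i \<and>
      (f i = 0 \<longrightarrow> x i = 0 \<and> y i = 0)"
    by metis
  then have parts: "x i \<in> part (S i) 0" "y i \<in> part (S i) 1"
    and sum: "x i + y i = f i"
    and zero: "f i = 0 \<Longrightarrow> x i = 0" "f i = 0 \<Longrightarrow> y i = 0" if "i \<in> I" for i
    using *[OF that] by metis+
  let ?x = "\<lambda>i. if i \<in> I then x i else 0" and ?y = "\<lambda>i. if i \<in> I then y i else 0"
  have "finite {i. ?x i \<noteq> 0}" "finite {i. ?y i \<noteq> 0}"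
  proof -
    have sub: "{i. ?x i \<noteq> 0} \<subseteq> {i. f i \<noteq> 0}" "{i. ?y i \<noteq> 0} \<subseteq> {i. f i \<noteq> 0}"
      using zero by auto
    have fin: "finite {i. f i \<noteq> 0}"
      using f by simp
    show "finite {i. ?x i \<noteq> 0}" "finite {i. ?y i \<noteq> 0}"
      by (rule finite_subset[OF sub(1) fin], rule finite_subset[OF sub(2) fin])
  qed
  then have "?x \<in> part (rep_Sum I S) 0" "?y \<in> part (rep_Sum I S) 1"
    using parts by (simp_all add: rep_Sum_simps)
  moreover have "f = ?x + ?y"
  proof
    fix i show "f i = (?x + ?y) i"
      using f by (cases "i \<in> I") (simp_all add: sum)
  qed
  ultimately show "f \<in> space_of (rep_Sum I S)"
    unfolding space_of_def by (intro CollectI exI conjI)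
qed

text \<open>The map out of a direct sum induced by maps on the summands. Summing over the support
  keeps the sum finite when the index set is infinite.\<close>

definition sum_map :: "('i \<Rightarrow> 'w::zero \<Rightarrow> 'v::comm_monoid_add) \<Rightarrow> ('i \<Rightarrow> 'w) \<Rightarrow> 'v"
  where "sum_map h f = (\<Sum>i | f i \<noteq> 0. h i (f i))"

lemma sum_map_eq_sum:
  assumes "finite F" "{i. f i \<noteq> 0} \<subseteq> F" "\<And>i. i \<in> F \<Longrightarrow> h i 0 = 0"
  shows "sum_map h f = (\<Sum>i\<in>F. h i (f i))"
  unfolding sum_map_def by (rule sum.mono_neutral_left) (use assms in auto)

context
  fixes I :: "'i set" and S :: "'i \<Rightarrow> 'w::complex_vector super_rep"
  assumes st: "\<And>i. i \<in> I \<Longrightarrow> stable_rep (S i)"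
    and act_0: "\<And>i t. i \<in> I \<Longrightarrow> t \<in> circle \<Longrightarrow> act (S i) t 0 = 0"
    and lie_0: "\<And>i X. i \<in> I \<Longrightarrow> lie (S i) X 0 = 0"
begin

text \<open>Linearity of the summands is not assumed, so their maps are asked separately to fix 0;
  this keeps supports finite.\<close>

lemma supp_act_subset: "t \<in> circle \<Longrightarrow> {i. act (rep_Sum I S) t f i \<noteq> 0} \<subseteq> {i. f i \<noteq> 0}"
  and supp_lie_subset: "{i. lie (rep_Sum I S) X f i \<noteq> 0} \<subseteq> {i. f i \<noteq> 0}"
  by (auto simp: rep_Sum_simps act_0 lie_0 split: if_splits)

lemma stable_rep_Sum: "stable_rep (rep_Sum I S)"
  unfolding stable_rep_def
proof (intro conjI allI ballI)
  show "complex_vector.subspace (part (rep_Sum I S) p)" for p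
  proof (rule complex_vector.subspaceI)
    note * = stable_subspace[OF st]
    show "0 \<in> part (rep_Sum I S) p"
      using * by (auto simp: rep_Sum_simps complex_vector.subspace_0)
    fix f assume f: "f \<in> part (rep_Sum I S) p"
    { fix g assume g: "g \<in> part (rep_Sum I S) p"
      have "{i. (f + g) i \<noteq> 0} \<subseteq> {i. f i \<noteq> 0} \<union> {i. g i \<noteq> 0}"
        by auto
      then have "finite {i. (f + g) i \<noteq> 0}"
        using f g by (auto simp: rep_Sum_simps intro: finite_subset)
      then show "f + g \<in> part (rep_Sum I S) p"
        using f g * by (auto simp: rep_Sum_simps complex_vector.subspace_add) }
    fix c
    have "{i. (c *\<^sub>C f) i \<noteq> 0} \<subseteq> {i. f i \<noteq> 0}"
      by (auto simp: scaleC_fun_def)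
    then have "finite {i. (c *\<^sub>C f) i \<noteq> 0}"
      using f by (auto simp: rep_Sum_simps intro: finite_subset)
    then show "c *\<^sub>C f \<in> part (rep_Sum I S) p"
      using f * by (auto simp: rep_Sum_simps complex_vector.subspace_scale scaleC_fun_def)
  qed
  fix t :: complex assume t: "t \<in> circle"
  show "act (rep_Sum I S) t ` part (rep_Sum I S) p \<subseteq> part (rep_Sum I S) p" for p
  proof clarify
    fix f assume f: "f \<in> part (rep_Sum I S) p"
    then have "finite {i. act (rep_Sum I S) t f i \<noteq> 0}"
      using supp_act_subset[OF t, of f] by (auto simp: rep_Sum_simps(1) intro: finite_subset)
    then show "act (rep_Sum I S) t f \<in> part (rep_Sum I S) p"
      using f stable_act_part[OF st t] by (auto simp: rep_Sum_simps)
  qed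
  show "act (rep_Sum I S) t ` space_of (rep_Sum I S) \<subseteq> space_of (rep_Sum I S)"
  proof clarify
    fix f assume f: "f \<in> space_of (rep_Sum I S)"
    then have "finite {i. act (rep_Sum I S) t f i \<noteq> 0}"
      using supp_act_subset[OF t, of f] by (auto simp: space_of_rep_Sum[OF st] intro: finite_subset)
    then show "act (rep_Sum I S) t f \<in> space_of (rep_Sum I S)"
      using f stable_act[OF st t] by (auto simp: rep_Sum_simps space_of_rep_Sum[OF st])
  qed
next
  fix p q and X :: "real \<times> real" assume X: "X \<in> std_part p"
  show "lie (rep_Sum I S) X ` part (rep_Sum I S) q \<subseteq> part (rep_Sum I S) (p + q)"
  proof clarify
    fix f assume f: "f \<in> part (rep_Sum I S) q"
    then have "finite {i. lie (rep_Sum I S) X f i \<noteq> 0}"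
      using supp_lie_subset[of X f] by (auto simp: rep_Sum_simps(1) intro: finite_subset)
    then show "lie (rep_Sum I S) X f \<in> part (rep_Sum I S) (p + q)"
      using f stable_lie_part[OF st X] by (auto simp: rep_Sum_simps)
  qed
next
  fix X :: "real \<times> real"
  show "lie (rep_Sum I S) X ` space_of (rep_Sum I S) \<subseteq> space_of (rep_Sum I S)"
  proof clarify
    fix f assume f: "f \<in> space_of (rep_Sum I S)"
    then have "finite {i. lie (rep_Sum I S) X f i \<noteq> 0}"
      using supp_lie_subset[of X f] by (auto simp: space_of_rep_Sum[OF st] intro: finite_subset)
    then show "lie (rep_Sum I S) X f \<in> space_of (rep_Sum I S)"
      using f stable_lie[OF st] by (auto simp: rep_Sum_simps space_of_rep_Sum[OF st])
  qed
qed

lemma rep_hom_rep_Sum: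
  fixes R :: "'v::complex_vector super_rep"
  assumes R: "supercircle_rep R" and hom: "\<And>i. i \<in> I \<Longrightarrow> rep_hom (S i) R (h i)"
  shows "rep_hom (rep_Sum I S) R (sum_map h)"
proof -
  interpret supercircle R by standard fact
  have h0: "h i 0 = 0" if "i \<in> I" for i
    using linear_on_zero[OF hom_linear[OF hom] stable_space_subspace[OF st]] that by blast
  let ?S = "space_of (rep_Sum I S)"
  have eq: "sum_map h g = (\<Sum>i\<in>F. h i (g i))"
    if "finite F" "{i. g i \<noteq> 0} \<subseteq> F" "F \<subseteq> I" for g F
    using that h0 by (intro sum_map_eq_sum) auto
  have supp: "finite {i. f i \<noteq> 0}" "{i. f i \<noteq> 0} \<subseteq> I" "\<And>i. i \<in> I \<Longrightarrow> f i \<in> space_of (S i)"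
    if "f \<in> ?S" for f
    using that by (auto simp: space_of_rep_Sum[OF st])
  show ?thesis
    unfolding rep_hom_def
  proof (intro conjI allI ballI linear_onI)
    fix f g assume f: "f \<in> ?S" and g: "g \<in> ?S"
    \<comment> \<open>The supports of \<open>f\<close>, \<open>g\<close> and \<open>f + g\<close>
      differ, so all three sums are taken over one common finite set.\<close>
    let ?F = "{i. f i \<noteq> 0} \<union> {i. g i \<noteq> 0}"
    have F: "finite ?F" "?F \<subseteq> I"
      using supp[OF f] supp[OF g] by auto
    have "h i ((f + g) i) = h i (f i) + h i (g i)" if "i \<in> ?F" for i
    proof -
      have "i \<in> I"
        using F(2) that by (rule subsetD)
      then show ?thesis
        using linear_on_add[OF hom_linear[OF hom], of i "f i" "g i"] supp(3)[OF f] supp(3)[OF g] by simp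
    qed
    moreover have "sum_map h (f + g) = (\<Sum>i\<in>?F. h i ((f + g) i))"
      by (rule eq) (use F in auto)
    moreover have "sum_map h f = (\<Sum>i\<in>?F. h i (f i))" "sum_map h g = (\<Sum>i\<in>?F. h i (g i))"
      by (rule eq; use F in auto)+
    ultimately show "sum_map h (f + g) = sum_map h f + sum_map h g"
      by (simp add: sum.distrib)
  next
    fix c f assume f: "f \<in> ?S"
    let ?F = "{i. f i \<noteq> 0}"
    note F = supp(1,2)[OF f]
    have "h i ((c *\<^sub>C f) i) = c *\<^sub>C h i (f i)" if "i \<in> ?F" for i
    proof -
      have "i \<in> I"
        using F(2) that by (rule subsetD)
      then show ?thesis
        using linear_on_scale[OF hom_linear[OF hom], of i "f i" c] supp(3)[OF f] by (simp add: scaleC_fun_def)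
    qed
    moreover have "sum_map h (c *\<^sub>C f) = (\<Sum>i\<in>?F. h i ((c *\<^sub>C f) i))"
      by (rule eq) (use F in \<open>auto simp: scaleC_fun_def\<close>)
    ultimately show "sum_map h (c *\<^sub>C f) = c *\<^sub>C sum_map h f"
      by (simp add: sum_map_def complex_vector.scale_sum_right)
  next
    fix p
    show "sum_map h ` part (rep_Sum I S) p \<subseteq> part R p"
    proof clarify
      fix f assume f: "f \<in> part (rep_Sum I S) p"
      show "sum_map h f \<in> part R p"
        unfolding sum_map_def
      proof (rule complex_vector.subspace_sum[OF part_subspace])
        fix i assume "i \<in> {i. f i \<noteq> 0}"
        then have i: "i \<in> I"
          using f by (auto simp: rep_Sum_simps)
        then show "h i (f i) \<in> part R p"
          using f by (intro hom_part[OF hom[OF i]]) (simp add: rep_Sum_simps)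
      qed
    qed
  next
    fix t :: complex and f assume t: "t \<in> circle" and f: "f \<in> ?S"
    note F = supp[OF f]
    have "sum_map h (act (rep_Sum I S) t f) = (\<Sum>i | f i \<noteq> 0. h i (act (rep_Sum I S) t f i))"
      by (rule eq) (use F supp_act_subset[OF t] in auto)
    also have "\<dots> = (\<Sum>i | f i \<noteq> 0. act R t (h i (f i)))"
      by (rule sum.cong) (use F t hom_act[OF hom] in \<open>auto simp: rep_Sum_simps\<close>)
    also have "\<dots> = act R t (sum_map h f)"
      unfolding sum_map_def
      by (rule linear_on_sum[OF act_linear[OF t] V_subspace, symmetric])
        (use F hom_space[OF hom st] in auto)
    finally show "sum_map h (act (rep_Sum I S) t f) = act R t (sum_map h f)" .
  next
    fix X f assume f: "f \<in> ?S"
    note F = supp[OF f]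
    have "sum_map h (lie (rep_Sum I S) X f) = (\<Sum>i | f i \<noteq> 0. h i (lie (rep_Sum I S) X f i))"
      by (rule eq) (use F supp_lie_subset in auto)
    also have "\<dots> = (\<Sum>i | f i \<noteq> 0. lie R X (h i (f i)))"
      by (rule sum.cong) (use F hom_lie[OF hom] in \<open>auto simp: rep_Sum_simps\<close>)
    also have "\<dots> = lie R X (sum_map h f)"
      unfolding sum_map_def
      by (rule linear_on_sum[OF lie_linear V_subspace, symmetric])
        (use F hom_space[OF hom st] in auto)
    finally show "sum_map h (lie (rep_Sum I S) X f) = lie R X (sum_map h f)" .
  qed
qed

end

lemma sum_map_single:
  assumes "i \<in> I" "\<And>i. i \<in> I \<Longrightarrow> stable_rep (S i)" "x \<in> space_of (S i)" "h i 0 = 0"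
  shows "h i x \<in> sum_map h ` space_of (rep_Sum I S)"
proof
  let ?f = "(\<lambda>_. 0)(i := x)"
  have supp: "{k. ?f k \<noteq> 0} \<subseteq> {i}"
    by auto
  then show "h i x = sum_map h ?f"
    using sum_map_eq_sum[of "{i}" ?f h] assms(4) by simp
  have "0 \<in> space_of (S k)" if "k \<in> I" for k
    using stable_space_subspace[OF assms(2)[OF that]] by (rule complex_vector.subspace_0)
  then show "?f \<in> space_of (rep_Sum I S)"
    using assms(1,3) finite_subset[OF supp] by (auto simp: space_of_rep_Sum[OF assms(2)])
qed

section \<open>The indecomposable summands\<close>

lemma fst_scaleC [simp]: "fst (c *\<^sub>C x) = c *\<^sub>C fst x"
  and snd_scaleC [simp]: "snd (c *\<^sub>C x) = c *\<^sub>C snd x"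
  by (simp_all add: scaleC_prod_def)

lemma std_part_subspace: "complex_vector.subspace (std_part p :: ('a::complex_vector \<times> 'a) set)"
  by (auto simp: std_part_def complex_vector.subspace_def)

lemma std_parts_space:
  assumes "part R = std_part \<or> part R = (\<lambda>p. std_part (p + 1))"
  shows "space_of R = (UNIV :: ('a::complex_vector \<times> 'a) set)"
proof -
  have "\<exists>x\<in>part R 0. \<exists>y\<in>part R 1. v = x + y" for v
    using assms
  proof
    assume "part R = std_part"
    then show ?thesis
      by (intro bexI[of _ "(fst v, 0)"] bexI[of _ "(0, snd v)"]) (simp_all add: std_part_def)
  next
    assume "part R = (\<lambda>p. std_part (p + 1))"
    then show ?thesis
      by (intro bexI[of _ "(0, snd v)"] bexI[of _ "(fst v, 0)"]) (simp_all add: std_part_def)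
  qed
  then show ?thesis
    unfolding space_of_def by blast
qed

lemma super_weight_rep_simps:
  "part (super_weight_rep m) = std_part"
  "act (super_weight_rep m) t v = (t powi m) *\<^sub>C v"
  "lie (super_weight_rep m) X v = (of_real (fst X) * (\<i> * of_int m)) *\<^sub>C v
       + (of_real (snd X) * csqrt (- (\<i> * of_int m))) *\<^sub>C prod.swap v"
  "space_of (super_weight_rep m) = UNIV"
  by (simp_all add: super_weight_rep_def std_parts_space)

lemma adjoint_rep_simps:
  "part adjoint_rep = std_part" "part (parity_reversal adjoint_rep) p = std_part (p + 1)"
  "act adjoint_rep t v = v" "act (parity_reversal adjoint_rep) t v = v"
  "lie adjoint_rep X v = (- 2 * (of_real (snd X) * snd v), 0)"
  "lie (parity_reversal adjoint_rep) X v = (- 2 * (of_real (snd X) * snd v), 0)"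
  "space_of adjoint_rep = UNIV" "space_of (parity_reversal adjoint_rep) = UNIV"
  by (simp_all add: adjoint_rep_def parity_reversal_def lie_bracket_def std_parts_space)

lemma stable_super_weight_rep: "stable_rep (super_weight_rep m)"
  unfolding stable_rep_def super_weight_rep_simps bit_all_iff
  using std_part_subspace[of 0, where 'a = complex] std_part_subspace[of 1, where 'a = complex]
  by (auto simp: std_part_def)

lemma stable_adjoint_rep: "stable_rep adjoint_rep"
  unfolding stable_rep_def adjoint_rep_simps bit_all_iff
  using std_part_subspace[of 0, where 'a = complex] std_part_subspace[of 1, where 'a = complex]
  by (auto simp: std_part_def)

lemma stable_parity_reversal_adjoint_rep: "stable_rep (parity_reversal adjoint_rep)"
  unfolding stable_rep_def adjoint_rep_simps bit_all_iff
  using std_part_subspace[of 0, where 'a = complex] std_part_subspace[of 1, where 'a = complex]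
  by (auto simp: std_part_def)

text \<open>\<open>rep_isomorphic\<close> demands the axioms on both sides, so this model is checked
  directly. Brackets land in the multiples of \<open>C\<close>, which is central, so all double
  brackets vanish.\<close>

lemma supercircle_rep_adjoint_rep: "supercircle_rep adjoint_rep"
  unfolding supercircle_rep_def
proof (intro conjI)
  show "super_space adjoint_rep"
    using std_part_subspace[where 'a = complex]
    by (simp add: super_space_def adjoint_rep_simps) (auto simp: std_part_def zero_prod_def)
  show "circle_rep adjoint_rep"
    by (auto simp: circle_rep_def adjoint_rep_simps linear_on_def)
  show "lie_rep adjoint_rep"
    unfolding lie_rep_def adjoint_rep_simps bit_all_iff
    by (auto simp: linear_on_def std_part_def algebra_simps lie_bracket_def scaleC_prod_def
        zero_prod_def)
  show "differential_compatible adjoint_rep"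
    by (auto simp: differential_compatible_def adjoint_rep_simps lie_C_def
        complex_vector_pair.linear_0 zero_prod_def[symmetric])
  show "\<forall>t\<in>circle. \<forall>v\<in>space_of adjoint_rep.
      lie adjoint_rep lie_Z (act adjoint_rep t v) = act adjoint_rep t (lie adjoint_rep lie_Z v)"
    by (simp add: adjoint_rep_simps)
qed

lemma supercircle_rep_parity_reversal_adjoint_rep: "supercircle_rep (parity_reversal adjoint_rep)"
  unfolding supercircle_rep_def
proof (intro conjI)
  show "super_space (parity_reversal adjoint_rep)"
    using std_part_subspace[where 'a = complex]
    by (simp add: super_space_def adjoint_rep_simps) (auto simp: std_part_def zero_prod_def)
  show "circle_rep (parity_reversal adjoint_rep)"
    by (auto simp: circle_rep_def adjoint_rep_simps linear_on_def)
  show "lie_rep (parity_reversal adjoint_rep)"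
    unfolding lie_rep_def adjoint_rep_simps bit_all_iff
    by (auto simp: linear_on_def std_part_def algebra_simps lie_bracket_def scaleC_prod_def
        zero_prod_def)
  show "differential_compatible (parity_reversal adjoint_rep)"
    by (auto simp: differential_compatible_def adjoint_rep_simps lie_C_def
        complex_vector_pair.linear_0 zero_prod_def[symmetric])
  show "\<forall>t\<in>circle. \<forall>v\<in>space_of (parity_reversal adjoint_rep).
      lie (parity_reversal adjoint_rep) lie_Z (act (parity_reversal adjoint_rep) t v) =
      act (parity_reversal adjoint_rep) t (lie (parity_reversal adjoint_rep) lie_Z v)"
    by (simp add: adjoint_rep_simps)
qed

context supercircle
begin

text \<open>Sends \<open>(1, 0)\<close> to \<open>e\<close>. The image of \<open>(0, 1)\<close> is
  then forced: in the model \<open>Z\<close> maps \<open>(1, 0)\<close> to the square root times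
  \<open>(0, 1)\<close>, hence the division.\<close>

definition weight_hom :: "int \<Rightarrow> 'v \<Rightarrow> complex \<times> complex \<Rightarrow> 'v"
  where "weight_hom m e v = fst v *\<^sub>C e + (snd v / csqrt (- (\<i> * of_int m))) *\<^sub>C Z e"

text \<open>In the adjoint representation \<open>Z\<close> sends \<open>(0, 1)\<close> to \<open>(- 2, 0)\<close>, hence the factor \<open>- 1/2\<close>.\<close>

definition nilpotent_hom :: "'v \<Rightarrow> complex \<times> complex \<Rightarrow> 'v"
  where "nilpotent_hom e v = snd v *\<^sub>C e - (fst v / 2) *\<^sub>C Z e"

lemma weight_space_V: "v \<in> weight_space R m \<Longrightarrow> v \<in> V"
  and weight_space_A: "v \<in> weight_space R m \<Longrightarrow> A v = (\<i> * of_int m) *\<^sub>C v"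
  by (simp_all add: weight_space_eq)

lemma weight_space_act: "v \<in> weight_space R m \<Longrightarrow> t \<in> circle \<Longrightarrow> act R t v = (t powi m) *\<^sub>C v"
  by (simp add: weight_space_def)

lemma weight_space_subspace: "complex_vector.subspace (weight_space R m)"
  unfolding complex_vector.subspace_def weight_space_eq
  using linear_on_zero[OF lie_linear V_subspace]
  by (auto simp: V_closed linear_on_add[OF lie_linear] linear_on_scale[OF lie_linear]
      scaleC_add_right scaleC_scaleC mult.commute)

lemma weight_space_Z: "v \<in> weight_space R m \<Longrightarrow> Z v \<in> weight_space R m"
  by (simp add: weight_space_eq lie_V Z_A[symmetric] linear_on_scale[OF lie_linear])

lemma Z_Z_weight: "v \<in> weight_space R m \<Longrightarrow> Z (Z v) = (- (\<i> * of_int m)) *\<^sub>C v"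
  by (simp add: Z_Z weight_space_V weight_space_A)

text \<open>\<open>A\<close> is even, so the eigenvector equation can be compared parity by
  parity.\<close>

lemma weight_space_split:
  assumes "x \<in> part R p" "y \<in> part R (p + 1)" "x + y \<in> weight_space R m"
  shows "x \<in> weight_space R m" "y \<in> weight_space R m"
proof -
  have V: "x \<in> V" "y \<in> V"
    using assms part_subset by blast+
  have "A x + A y = (\<i> * of_int m) *\<^sub>C x + (\<i> * of_int m) *\<^sub>C y"
    using assms(3) V by (simp add: weight_space_eq linear_on_add[OF lie_linear] scaleC_add_right)
  note eqs = split_eq[where p = p, OF _ _ _ _ this]
  have "A x = (\<i> * of_int m) *\<^sub>C x" "A y = (\<i> * of_int m) *\<^sub>C y"
    by (rule eqs; use assms in \<open>simp add: A_part part_closed\<close>)+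
  with V show "x \<in> weight_space R m" "y \<in> weight_space R m"
    by (simp_all add: weight_space_eq)
qed

lemma rep_hom_weight_hom:
  assumes "e \<in> part R 0" "e \<in> weight_space R m" "m \<noteq> 0"
  shows "rep_hom (super_weight_rep m) R (weight_hom m e)"
proof -
  define s where "s = csqrt (- (\<i> * of_int m))"
  have s2: "s * s = - (\<i> * of_int m)"
    unfolding s_def by (metis power2_csqrt power2_eq_square)
  then have s0: "s \<noteq> 0"
    using assms(3) by auto
  have V: "e \<in> V" "Z e \<in> V"
    using assms(1) part_subset lie_V by blast+
  have Ze: "Z e \<in> part R 1" "Z e \<in> weight_space R m"
    using Z_part[OF assms(1)] weight_space_Z[OF assms(2)] by simp_all
  note simps = weight_hom_def s_def[symmetric]
  note vec = scaleC_add_right scaleC_add_left scaleC_scaleC add_divide_distrib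
  show ?thesis
    unfolding rep_hom_def super_weight_rep_simps bit_all_iff
  proof (intro conjI allI ballI linear_onI)
    show "weight_hom m e ` std_part 0 \<subseteq> part R 0" "weight_hom m e ` std_part 1 \<subseteq> part R 1"
      using assms(1) Ze(1) by (auto simp: simps std_part_def part_closed)
  next
    fix t :: complex and v assume "t \<in> circle"
    then show "weight_hom m e ((t powi m) *\<^sub>C v) = act R t (weight_hom m e v)"
      using V assms(2) Ze(2) by (simp add: simps vec linear_on_add[OF act_linear]
          linear_on_scale[OF act_linear] V_closed weight_space_act mult.commute)
  next
    fix X :: "real \<times> real" and v
    let ?a = "of_real (fst X) :: complex" and ?b = "of_real (snd X) :: complex" and ?m = "\<i> * of_int m"
    have "lie R X (weight_hom m e v)
        = ?a *\<^sub>C A (weight_hom m e v) + ?b *\<^sub>C Z (weight_hom m e v)"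
      using V by (intro lie_eq) (simp add: simps V_closed)
    also have "A (weight_hom m e v) = (fst v * ?m) *\<^sub>C e + (snd v / s * ?m) *\<^sub>C Z e"
      using V by (simp add: simps linear_on_add[OF lie_linear] linear_on_scale[OF lie_linear]
          V_closed weight_space_A[OF assms(2)] weight_space_A[OF Ze(2)] scaleC_scaleC)
    \<comment> \<open>The scalar by which \<open>Z^2\<close> acts is kept as \<open>s * s\<close>:
      one factor cancels the division in \<open>weight_hom\<close>, the other is the square root in
      the model.\<close>
    also have "Z (weight_hom m e v) = fst v *\<^sub>C Z e + (snd v / s * (s * s)) *\<^sub>C e"
      using V by (simp add: simps s2 linear_on_add[OF lie_linear] linear_on_scale[OF lie_linear]
          V_closed Z_Z_weight[OF assms(2)] scaleC_scaleC)
    also have "?a *\<^sub>C ((fst v * ?m) *\<^sub>C e + (snd v / s * ?m) *\<^sub>C Z e)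
          + ?b *\<^sub>C (fst v *\<^sub>C Z e + (snd v / s * (s * s)) *\<^sub>C e)
        = (?a * (fst v * ?m) + ?b * (snd v / s * (s * s))) *\<^sub>C e
          + (?a * (snd v / s * ?m) + ?b * fst v) *\<^sub>C Z e"
      by (simp only: vec) (simp only: ac_simps)
    also have "\<dots> = weight_hom m e ((?a * ?m) *\<^sub>C v + (?b * s) *\<^sub>C prod.swap v)"
    proof -
      have "?a * (fst v * ?m) + ?b * (snd v / s * (s * s)) = ?a * ?m * fst v + ?b * s * snd v"
        "?a * (snd v / s * ?m) + ?b * fst v = (?a * ?m * snd v + ?b * s * fst v) / s"
        using s0 by (simp_all add: field_simps)
      then show ?thesis
        by (simp add: simps)
    qed
    finally show "weight_hom m e ((?a * ?m) *\<^sub>C v + (?b * csqrt (- ?m)) *\<^sub>C prod.swap v)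
        = lie R X (weight_hom m e v)"
      by (simp only: s_def)
  qed (simp_all add: simps vec algebra_simps)
qed

text \<open>In both models \<open>Z\<close> maps the second coordinate to the first, so the
  generator \<open>e\<close> occupies the second. That coordinate is odd in
  \<open>adjoint_rep\<close>, hence an even \<open>e\<close> calls for the parity reversal.\<close>

lemma rep_hom_nilpotent_hom:
  assumes "e \<in> weight_space R 0" and "p = 0 \<or> p = 1" "e \<in> part R p"
  shows "rep_hom (if p = 0 then parity_reversal adjoint_rep else adjoint_rep) R (nilpotent_hom e)"
proof -
  have V: "e \<in> V" "Z e \<in> V"
    using assms(1) weight_space_V lie_V by blast+
  have Ze: "Z e \<in> part R (p + 1)" "Z e \<in> weight_space R 0"
    using Z_part[OF assms(3)] weight_space_Z[OF assms(1)] by simp_all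
  have A0: "A e = 0" "A (Z e) = 0" "Z (Z e) = 0"
    using weight_space_A[OF assms(1)] weight_space_A[OF Ze(2)] Z_Z_weight[OF assms(1)] by simp_all
  have act1: "act R t e = e" "act R t (Z e) = Z e" if "t \<in> circle" for t
    using weight_space_act[OF assms(1) that] weight_space_act[OF Ze(2) that] by (simp_all add: scaleC_one)
  let ?W = "if p = 0 then parity_reversal adjoint_rep else adjoint_rep"
  have W: "act ?W t v = v" "lie ?W X v = (- 2 * (of_real (snd X) * snd v), 0)" "space_of ?W = UNIV" for t X v
    by (auto simp: adjoint_rep_simps)
  have N: "nilpotent_hom e v \<in> V" for v
    using V by (simp add: nilpotent_hom_def V_closed)
  have lin: "linear_on UNIV (nilpotent_hom e)"
    by (rule linear_onI) (simp_all add: nilpotent_hom_def scaleC_add_left scaleC_add_right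
        scaleC_scaleC add_divide_distrib complex_vector.scale_right_diff_distrib algebra_simps)
  show ?thesis
    unfolding rep_hom_def W
  proof (intro conjI allI ballI lin)
    show "nilpotent_hom e ` part ?W q \<subseteq> part R q" for q
      using assms(2,3) Ze(1)
      by (cases q) (auto simp: adjoint_rep_simps nilpotent_hom_def std_part_def part_closed)
  next
    fix t :: complex and v assume "t \<in> circle"
    then show "nilpotent_hom e v = act R t (nilpotent_hom e v)"
      using V by (simp add: nilpotent_hom_def linear_on_diff[OF act_linear V_subspace]
          linear_on_scale[OF act_linear] V_closed act1)
  next
    fix X :: "real \<times> real" and v
    have "A (nilpotent_hom e v) = 0" "Z (nilpotent_hom e v) = snd v *\<^sub>C Z e"
      using V by (simp_all add: nilpotent_hom_def linear_on_diff[OF lie_linear V_subspace]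
          linear_on_scale[OF lie_linear] V_closed A0)
    then have "lie R X (nilpotent_hom e v) = of_real (snd X) *\<^sub>C snd v *\<^sub>C Z e"
      using lie_eq[OF N, of X v] by simp
    then show "nilpotent_hom e (- 2 * (of_real (snd X) * snd v), 0) = lie R X (nilpotent_hom e v)"
      by (simp add: nilpotent_hom_def scaleC_scaleC)
  qed
qed

end

section \<open>The decomposition\<close>

context supercircle
begin

text \<open>Only even vectors are collected; the odd ones of nonzero weight are their images under
  \<open>Z\<close>.\<close>

definition nonzero_weight_vectors :: "'v set"
  where "nonzero_weight_vectors = {v \<in> part R 0. \<exists>m. m \<noteq> 0 \<and> v \<in> weight_space R m}"

definition homogeneous_null_vectors :: "'v set"
  where "homogeneous_null_vectors = {v \<in> weight_space R 0. \<exists>p. v \<in> part R p}"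

lemma weight_space_zero_split:
  assumes "v \<in> weight_space R 0"
  obtains x y where "x \<in> part R p" "y \<in> part R (p + 1)" "v = x + y"
    "x \<in> weight_space R 0" "y \<in> weight_space R 0"
proof -
  obtain x y where "x \<in> part R p" "y \<in> part R (p + 1)" "v = x + y"
    using V_split[OF weight_space_V[OF assms], of p] .
  with weight_space_split[of x p y 0] assms show thesis
    by (intro that[of x y]) auto
qed

text \<open>On weight \<open>m\<close> the operator \<open>A\<close> is a nonzero scalar and can be
  inverted. The range of \<open>A\<close> thus holds sums of vectors of different nonzero weights in
  a single subspace.\<close>

lemma span_nonzero_weight_vectors_subset:
  "complex_vector.span nonzero_weight_vectors \<subseteq> part R 0 \<inter> A ` V"
proof (rule complex_vector.span_minimal)
  show "complex_vector.subspace (part R 0 \<inter> A ` V)"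
    by (intro complex_vector.subspace_inter part_subspace linear_on_image_subspace[OF lie_linear V_subspace])
  show "nonzero_weight_vectors \<subseteq> part R 0 \<inter> A ` V"
  proof
    fix v assume "v \<in> nonzero_weight_vectors"
    then obtain m where v: "v \<in> part R 0" "m \<noteq> 0" "v \<in> weight_space R m"
      by (auto simp: nonzero_weight_vectors_def)
    then have "v = A ((1 / (\<i> * of_int m)) *\<^sub>C v)"
      by (simp add: linear_on_scale[OF lie_linear] weight_space_V weight_space_A scaleC_scaleC scaleC_one)
    moreover have "(1 / (\<i> * of_int m)) *\<^sub>C v \<in> V"
      using v by (simp add: weight_space_V V_closed)
    ultimately show "v \<in> part R 0 \<inter> A ` V"
      using v(1) by blast
  qed
qed

lemma Z_range_A: "v \<in> A ` V \<Longrightarrow> Z v \<in> A ` V"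
  using Z_A lie_V by blast

text \<open>If \<open>Z v = 0\<close>, then \<open>A v = - Z (Z v) = 0\<close>, and a vector in both
  kernel and range of \<open>A\<close> is 0.\<close>

lemma Z_injective_on_range_A:
  assumes "v \<in> A ` V" "Z v = 0"
  shows "v = 0"
proof -
  obtain w where w: "w \<in> V" "v = A w"
    using assms(1) by blast
  then have "A v = 0"
    using assms(2) linear_on_zero[OF lie_linear V_subspace] by (simp add: A_eq[OF lie_V])
  with w show ?thesis
    using kernel_range_A_disjoint by blast
qed

text \<open>The criterion behind surjectivity: a \<open>Z\<close>-stable subspace is everything once
  it contains the even vectors of nonzero weight and all of weight zero.\<close>

lemma space_of_generated:
  assumes Q: "complex_vector.subspace Q" "\<And>v. v \<in> Q \<Longrightarrow> Z v \<in> Q" "nonzero_weight_vectors \<subseteq> Q"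
    "weight_space R 0 \<subseteq> Q"
  shows "V \<subseteq> Q"
proof -
  have "v \<in> Q" if v: "v \<in> weight_space R m" for v m
  proof (cases "m = 0")
    case False
    obtain x y where xy: "x \<in> part R 0" "y \<in> part R 1" "v = x + y"
      using V_split[OF weight_space_V[OF v], of 0] by auto
    then have w: "x \<in> weight_space R m" "y \<in> weight_space R m"
      using weight_space_split[of x 0 y m] v by auto
    have "x \<in> Q"
      using Q(3) xy(1) w(1) False by (auto simp: nonzero_weight_vectors_def)
    \<comment> \<open>The odd component is reached through its even image \<open>Z y\<close>, as
      \<open>Z (Z y)\<close> is a nonzero multiple of \<open>y\<close>.\<close>
    moreover have "Z y \<in> Q"
      using Q(3) Z_part[OF xy(2)] weight_space_Z[OF w(2)] False by (auto simp: nonzero_weight_vectors_def)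
    then have "(1 / (- (\<i> * of_int m))) *\<^sub>C Z (Z y) \<in> Q"
      using Q(1,2) complex_vector.subspace_scale by blast
    then have "y \<in> Q"
      using False by (simp add: Z_Z_weight[OF w(2)] scaleC_scaleC scaleC_one)
    ultimately show ?thesis
      using xy(3) Q(1) complex_vector.subspace_add by blast
  qed (use v Q(4) in blast)
  then have "(\<Union>m. weight_space R m) \<subseteq> Q"
    by blast
  from complex_vector.span_minimal[OF this Q(1)] show ?thesis
    using in_span_weight_vectors by (meson subset_iff)
qed

text \<open>Boundaries of the differential \<open>Z\<close>, in degree \<open>p\<close>. The
  restriction to weight zero is what makes \<open>Z\<close> square to zero.\<close>

definition exact_part :: "bit \<Rightarrow> 'v set"
  where "exact_part p = Z ` (weight_space R 0 \<inter> part R (p + 1))"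

definition closed_part :: "bit \<Rightarrow> 'v set"
  where "closed_part p = {v \<in> part R p. Z v = 0}"

text \<open>Cycles have weight zero automatically, because \<open>Z v = 0\<close> gives
  \<open>A v = - Z (Z v) = 0\<close>.\<close>

lemma closed_part_weight_zero: "closed_part p \<subseteq> weight_space R 0"
proof
  fix v assume "v \<in> closed_part p"
  then have "v \<in> V" "Z v = 0"
    using part_subset by (auto simp: closed_part_def)
  then show "v \<in> weight_space R 0"
    using linear_on_zero[OF lie_linear V_subspace] by (simp add: weight_space_eq A_eq)
qed

lemma exact_part_closed_part:
  "complex_vector.subspace (exact_part p)" "complex_vector.subspace (closed_part p)"
  "exact_part p \<subseteq> closed_part p"
proof -
  have *: "weight_space R 0 \<inter> part R (p + 1) \<subseteq> V"
    using part_subset by blast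
  have sub: "complex_vector.subspace (weight_space R 0 \<inter> part R (p + 1))"
    by (intro complex_vector.subspace_inter weight_space_subspace part_subspace)
  show "complex_vector.subspace (exact_part p)"
    unfolding exact_part_def by (rule linear_on_image_subspace[OF linear_on_subset[OF lie_linear *] sub])
  show "complex_vector.subspace (closed_part p)"
    unfolding closed_part_def
    by (rule linear_on_kernel_subspace[OF linear_on_subset[OF lie_linear part_subset] part_subspace])
  show "exact_part p \<subseteq> closed_part p"
  proof
    fix v assume "v \<in> exact_part p"
    then obtain w where w: "w \<in> weight_space R 0" "w \<in> part R (p + 1)" "v = Z w"
      by (auto simp: exact_part_def)
    have "v \<in> part R (p + 1 + 1)"
      unfolding w by (rule Z_part[OF w(2)])
    then have "v \<in> part R p"
      by (simp add: add.assoc)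
    then show "v \<in> closed_part p"
      using Z_Z_weight[OF w(1)] w(3) by (simp add: closed_part_def)
  qed
qed

end

text \<open>Bundles the choices that determine the decomposition; their existence is shown
  afterwards. Independence is asked of the vectors \<open>Z (g j)\<close>: applying \<open>Z\<close>
  to a relation among all \<open>g j\<close> and \<open>Z (g j)\<close> then kills first the
  coefficients of the \<open>g j\<close>, and what remains is a relation among the
  \<open>Z (g j)\<close>. \<open>P\<close> represents the cohomology of \<open>Z\<close>.\<close>

locale supercircle_decomposition = supercircle R for R :: "'v::complex_vector super_rep" +
  fixes I :: "nat set" and e :: "nat \<Rightarrow> 'v" and \<mu> :: "nat \<Rightarrow> int"
    and J :: "nat set" and g :: "nat \<Rightarrow> 'v" and P :: "bit \<Rightarrow> 'v set"
  assumes e: "\<And>i. i \<in> I \<Longrightarrow> e i \<in> part R 0 \<and> e i \<in> weight_space R (\<mu> i) \<and> \<mu> i \<noteq> 0"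
    and e_inj: "inj_on e I" and e_independent: "complex_vector.independent (e ` I)"
    and e_spans: "nonzero_weight_vectors \<subseteq> complex_vector.span (e ` I)"
    and g: "\<And>j. j \<in> J \<Longrightarrow> g j \<in> homogeneous_null_vectors"
    and Zg_inj: "inj_on (\<lambda>j. Z (g j)) J" and Zg_independent: "complex_vector.independent ((\<lambda>j. Z (g j)) ` J)"
    and Zg_spans: "Z ` homogeneous_null_vectors \<subseteq> complex_vector.span ((\<lambda>j. Z (g j)) ` J)"
    and P_subspace: "\<And>p. complex_vector.subspace (P p)" and P_closed: "\<And>p. P p \<subseteq> closed_part p"
    and P_exact: "\<And>p. P p \<inter> exact_part p = {0}"
    and P_sum: "\<And>p x. x \<in> closed_part p \<Longrightarrow> \<exists>s\<in>exact_part p. \<exists>u\<in>P p. x = s + u"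
begin

text \<open>Trivial by definition, on a subspace of the original space; \<open>rep_hom_U\<close>
  shows that \<open>R\<close> really acts this way on it.\<close>

definition U :: "'v super_rep"
  where "U = \<lparr>part = P, act = (\<lambda>t v. v), lie = (\<lambda>X v. 0)\<rparr>"

definition W :: "nat \<Rightarrow> (complex \<times> complex) super_rep"
  where "W j = (if g j \<in> part R 0 then parity_reversal adjoint_rep else adjoint_rep)"

lemma U_simps: "part U = P" "act U t v = v" "lie U X v = 0"
  by (simp_all add: U_def)

lemma P_weight_zero: "P p \<subseteq> weight_space R 0"
  using P_closed closed_part_weight_zero by blast

lemma space_of_U_subset: "space_of U \<subseteq> {v \<in> weight_space R 0. Z v = 0}"
proof
  fix v assume "v \<in> space_of U"
  then obtain x y where v: "x \<in> P 0" "y \<in> P 1" "v = x + y"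
    by (auto simp: space_of_def U_simps)
  then have "x \<in> weight_space R 0" "y \<in> weight_space R 0" "Z x = 0" "Z y = 0"
    using P_weight_zero P_closed by (auto simp: closed_part_def)
  then show "v \<in> {v \<in> weight_space R 0. Z v = 0}"
    unfolding v using complex_vector.subspace_add[OF weight_space_subspace]
    by (simp add: linear_on_add[OF lie_linear] weight_space_V)
qed

lemma stable_U: "stable_rep U"
proof -
  have "complex_vector.subspace (space_of U)"
    by (rule subspace_space_of) (simp add: U_simps P_subspace)
  then show ?thesis
    using P_subspace by (auto simp: stable_rep_def U_simps complex_vector.subspace_0)
qed

lemma rep_hom_U: "rep_hom U R (\<lambda>v. v)"
  unfolding rep_hom_def U_simps
proof (intro conjI allI ballI)
  show "linear_on (space_of U) (\<lambda>v. v)"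
    by (simp add: linear_on_def)
  show "(\<lambda>v. v) ` P p \<subseteq> part R p" for p
    using P_closed by (auto simp: closed_part_def)
  show "v = act R t v" if "t \<in> circle" "v \<in> space_of U" for t v
    using that space_of_U_subset weight_space_act[of v 0 t] by (auto simp: scaleC_one)
  show "0 = lie R X v" if v: "v \<in> space_of U" for X v
  proof -
    have "v \<in> weight_space R 0" "Z v = 0"
      using v space_of_U_subset by blast+
    then show ?thesis
      using lie_eq[OF weight_space_V, of v 0 X] weight_space_A[of v 0] by simp
  qed
qed

lemma trivial_rep_U: "trivial_rep U"
  using supercircle_rep_of_embedding[OF rep stable_U rep_hom_U] by (simp add: trivial_rep_def U_simps)

lemma stable_W: "stable_rep (W j)"
  and W_zero: "act (W j) t 0 = 0" "lie (W j) X 0 = 0"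
  and space_of_W: "space_of (W j) = UNIV"
  by (simp_all add: W_def stable_adjoint_rep stable_parity_reversal_adjoint_rep adjoint_rep_simps zero_prod_def)

lemma W_isomorphic:
  "rep_isomorphic (W j) adjoint_rep \<or> rep_isomorphic (W j) (parity_reversal adjoint_rep)"
  by (simp add: W_def rep_isomorphic_refl supercircle_rep_adjoint_rep supercircle_rep_parity_reversal_adjoint_rep)

lemma g_weight: "j \<in> J \<Longrightarrow> g j \<in> weight_space R 0"
  using g by (auto simp: homogeneous_null_vectors_def)

lemma rep_hom_W:
  assumes "j \<in> J"
  shows "rep_hom (W j) R (nilpotent_hom (g j))"
proof -
  have "g j \<in> part R 0 \<or> g j \<in> part R 1"
    using g[OF assms] by (auto simp: homogeneous_null_vectors_def) (metis bit_not_zero_iff)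
  then show ?thesis
    using rep_hom_nilpotent_hom[OF g_weight[OF assms], of 0] rep_hom_nilpotent_hom[OF g_weight[OF assms], of 1]
    by (auto simp: W_def)
qed

abbreviation S1 where "S1 \<equiv> rep_Sum I (\<lambda>i. super_weight_rep (\<mu> i))"
abbreviation S2 where "S2 \<equiv> rep_Sum J W"
abbreviation \<psi>1 where "\<psi>1 \<equiv> sum_map (\<lambda>i. weight_hom (\<mu> i) (e i))"
abbreviation \<psi>2 where "\<psi>2 \<equiv> sum_map (\<lambda>j. nilpotent_hom (g j))"

definition \<psi> :: "(nat \<Rightarrow> complex \<times> complex) \<times> 'v \<times> (nat \<Rightarrow> complex \<times> complex) \<Rightarrow> 'v"
  where "\<psi> x = \<psi>1 (fst x) + (fst (snd x) + \<psi>2 (snd (snd x)))"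

lemma super_weight_zero: "act (super_weight_rep m) t 0 = 0" "lie (super_weight_rep m) X 0 = 0"
  by (simp_all add: super_weight_rep_simps prod_eq_iff)

lemma stable_S1: "stable_rep S1" and stable_S2: "stable_rep S2"
  by (rule stable_rep_Sum; simp add: stable_super_weight_rep super_weight_zero stable_W W_zero)+

lemma rep_hom_S1: "rep_hom S1 R \<psi>1"
  by (rule rep_hom_rep_Sum[OF _ _ _ rep])
    (use e rep_hom_weight_hom in \<open>auto simp: stable_super_weight_rep super_weight_zero\<close>)

lemma rep_hom_S2: "rep_hom S2 R \<psi>2"
  by (rule rep_hom_rep_Sum[OF _ _ _ rep]) (auto simp: stable_W W_zero rep_hom_W)

lemma stable_target: "stable_rep (S1 \<oplus>\<^sub>R U \<oplus>\<^sub>R S2)"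
  by (intro stable_rep_plus stable_S1 stable_U stable_S2)

lemma rep_hom_target: "rep_hom (S1 \<oplus>\<^sub>R U \<oplus>\<^sub>R S2) R \<psi>"
proof -
  have "rep_hom (S1 \<oplus>\<^sub>R U \<oplus>\<^sub>R S2) R (\<lambda>x. \<psi>1 (fst x) + (\<lambda>y. fst y + \<psi>2 (snd y)) (snd x))"
    by (intro rep_hom_rep_plus[OF rep] stable_rep_plus stable_S1 stable_U stable_S2 rep_hom_S1 rep_hom_U rep_hom_S2)
  then show ?thesis
    by (simp add: \<psi>_def[abs_def])
qed

lemma space_of_S1: "space_of S1 = {f. finite {i. f i \<noteq> 0} \<and> {i. f i \<noteq> 0} \<subseteq> I}"
  and space_of_S2: "space_of S2 = {f. finite {i. f i \<noteq> 0} \<and> {i. f i \<noteq> 0} \<subseteq> J}"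
  by (auto simp: space_of_rep_Sum stable_super_weight_rep stable_W super_weight_rep_simps space_of_W)

text \<open>With the coefficients gathered into \<open>a\<close>, \<open>b\<close>,
  \<open>c\<close>, \<open>d\<close>, the image of \<open>x\<close> is
  \<open>(a + Z b) + (u + (c - Z d))\<close>. The first bracket lies in the range of
  \<open>A\<close> and the second in its kernel, so both vanish and can be treated
  separately.\<close>

lemma \<psi>_injective: "inj_on \<psi> (space_of (S1 \<oplus>\<^sub>R U \<oplus>\<^sub>R S2))"
proof (rule linear_on_inj_onI[OF hom_linear[OF rep_hom_target] stable_space_subspace[OF stable_target]])
  fix x assume "x \<in> space_of (S1 \<oplus>\<^sub>R U \<oplus>\<^sub>R S2)" and zero: "\<psi> x = 0"
  then obtain f u h where x: "x = (f, u, h)" "f \<in> space_of S1" "u \<in> space_of U" "h \<in> space_of S2"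
    by (cases x) (auto simp: space_of_rep_plus)
  define F where "F = {i. f i \<noteq> 0}"
  define G where "G = {j. h j \<noteq> 0}"
  have F: "finite F" "F \<subseteq> I" and G: "finite G" "G \<subseteq> J"
    using x by (simp_all add: space_of_S1 space_of_S2 F_def G_def)
  define s where "s i = csqrt (- (\<i> * of_int (\<mu> i)))" for i
  have s: "s i \<noteq> 0" if "i \<in> I" for i
    using e[OF that] by (simp add: s_def)
  define a where "a = (\<Sum>i\<in>F. fst (f i) *\<^sub>C e i)"
  define b where "b = (\<Sum>i\<in>F. (snd (f i) / s i) *\<^sub>C e i)"
  define c where "c = (\<Sum>j\<in>G. snd (h j) *\<^sub>C g j)"
  define d where "d = (\<Sum>j\<in>G. (fst (h j) / 2) *\<^sub>C g j)"
  have eP: "e i \<in> nonzero_weight_vectors" if "i \<in> F" for i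
    using e[OF subsetD[OF F(2) that]] by (auto simp: nonzero_weight_vectors_def)
  have ab_span: "a \<in> complex_vector.span nonzero_weight_vectors" "b \<in> complex_vector.span nonzero_weight_vectors"
    unfolding a_def b_def
    by (intro complex_vector.span_sum complex_vector.span_scale complex_vector.span_base eP; assumption)+
  then have ab: "a \<in> part R 0" "b \<in> part R 0" "a \<in> A ` V" "b \<in> A ` V"
    using span_nonzero_weight_vectors_subset by blast+
  have gV: "g j \<in> weight_space R 0" "g j \<in> V" if "j \<in> G" for j
    using g_weight G weight_space_V that by blast+
  have cd: "c \<in> weight_space R 0" "d \<in> weight_space R 0"
    unfolding c_def d_def
    by (intro complex_vector.subspace_sum[OF weight_space_subspace]
        complex_vector.subspace_scale[OF weight_space_subspace] gV; assumption)+
  have eV: "e i \<in> V" if "i \<in> F" for i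
    using e[of i] F that part_subset by blast
  have Zb: "Z b = (\<Sum>i\<in>F. (snd (f i) / s i) *\<^sub>C Z (e i))"
    unfolding b_def using eV
    by (simp add: linear_on_sum[OF lie_linear V_subspace] linear_on_scale[OF lie_linear] V_closed)
  have Zc: "Z c = (\<Sum>j\<in>G. snd (h j) *\<^sub>C Z (g j))" and Zd: "Z d = (\<Sum>j\<in>G. (fst (h j) / 2) *\<^sub>C Z (g j))"
    unfolding c_def d_def using gV
    by (simp_all add: linear_on_sum[OF lie_linear V_subspace] linear_on_scale[OF lie_linear] V_closed)
  have "\<psi>1 f = a + Z b"
    unfolding sum_map_def F_def[symmetric] weight_hom_def s_def[symmetric] Zb a_def by (rule sum.distrib)
  moreover have "\<psi>2 h = c - Z d"
    unfolding sum_map_def G_def[symmetric] nilpotent_hom_def Zd c_def by (rule sum_subtractf)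
  ultimately have sum0: "(a + Z b) + (u + (c - Z d)) = 0"
    using zero by (simp add: \<psi>_def x)
  have u: "u \<in> weight_space R 0" "Z u = 0"
    using x(3) space_of_U_subset by blast+
  have w0: "u + (c - Z d) \<in> weight_space R 0"
    by (intro complex_vector.subspace_add[OF weight_space_subspace]
        complex_vector.subspace_diff[OF weight_space_subspace] weight_space_Z u cd)
  have n: "a + Z b = - (u + (c - Z d))"
    using sum0 by (rule add_eq_0_iff2[THEN iffD1])
  have "a + Z b \<in> A ` V"
    by (intro complex_vector.subspace_add[OF linear_on_image_subspace[OF lie_linear V_subspace]] ab Z_range_A)
  then obtain v where v: "v \<in> V" "a + Z b = A v"
    by blast
  \<comment> \<open>This vector is in the range of \<open>A\<close> and, being minus a vector of
    weight zero, also in the kernel.\<close>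
  have "A v = 0"
    using kernel_range_A_disjoint[OF v(1)] v(2) n complex_vector.subspace_neg[OF weight_space_subspace w0]
    by (simp add: weight_space_eq)
  then have ab0: "a + Z b = 0 + 0" and uc0: "u + (c - Z d) = 0"
    using v n by auto
  \<comment> \<open>\<open>a\<close> is even and \<open>Z b\<close> is odd, so they cannot
    cancel.\<close>
  have "a = 0" "Z b = 0"
    using split_eq[of a 0 0 "Z b" 0, OF _ _ _ _ ab0] ab Z_part[of b 0] part_closed(1) by simp_all
  then have "b = 0"
    using Z_injective_on_range_A ab by blast
  have "f i = 0" if i: "i \<in> F" for i
  proof -
    have "fst (f i) = 0" "snd (f i) / s i = 0"
      by (rule independent_family_sum_zero[OF e_independent e_inj F _ i], fact \<open>a = 0\<close>[unfolded a_def],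
          rule independent_family_sum_zero[OF e_independent e_inj F _ i], fact \<open>b = 0\<close>[unfolded b_def])
    then show ?thesis
      using s[of i] F i by (auto simp: prod_eq_iff)
  qed
  then have "f = 0"
    by (auto simp: F_def fun_eq_iff)
  \<comment> \<open>Applying \<open>Z\<close> isolates \<open>c\<close>: both \<open>u\<close> and
    \<open>Z d\<close> are cycles. Independence of the \<open>Z (g j)\<close> then removes its
    coefficients.\<close>
  have "Z (u + (c - Z d)) = Z c"
    using u cd by (simp add: linear_on_add[OF lie_linear] linear_on_diff[OF lie_linear V_subspace]
        weight_space_V weight_space_Z V_closed lie_V Z_Z_weight)
  then have "Z c = 0"
    using uc0 linear_on_zero[OF lie_linear V_subspace] by simp
  note snd0 = independent_family_sum_zero[OF Zg_independent Zg_inj G this[unfolded Zc]]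
  then have "c = 0"
    by (simp add: c_def)
  then have ud: "u = Z d"
    using uc0 by simp
  obtain y z where yz: "y \<in> P 0" "z \<in> P 1" "u = y + z"
    using x(3) by (auto simp: space_of_def U_simps)
  obtain d0 d1 where d01: "d0 \<in> part R 0" "d1 \<in> part R (0 + 1)" "d = d0 + d1"
    "d0 \<in> weight_space R 0" "d1 \<in> weight_space R 0"
    using weight_space_zero_split[OF cd(2), of 0] .
  have eq: "y + z = Z d1 + Z d0"
    using ud yz d01 by (simp add: linear_on_add[OF lie_linear] weight_space_V add.commute)
  \<comment> \<open>\<open>Z\<close> reverses parity, so the even component of \<open>u\<close> is
    the image of the odd component of \<open>d\<close>. Each component of \<open>u\<close> is
    therefore exact, and \<open>P\<close> meets the exact vectors only in 0.\<close>
  have "y = Z d1" "z = Z d0"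
    using split_eq[of y 0 "Z d1" z "Z d0", OF _ _ _ _ eq] yz P_closed Z_part[OF d01(1)] Z_part[OF d01(2)]
    by (auto simp: closed_part_def)
  then have "y \<in> exact_part 0" "z \<in> exact_part 1"
    using d01 by (auto simp: exact_part_def)
  then have "y = 0" "z = 0"
    using yz P_exact[of 0] P_exact[of 1] by blast+
  then have "u = 0"
    using yz(3) by simp
  with ud have "Z d = 0"
    by simp
  note fst0 = independent_family_sum_zero[OF Zg_independent Zg_inj G this[unfolded Zd]]
  have "h j = 0" for j
    using snd0[of j] fst0[of j] by (cases "j \<in> G") (simp_all add: G_def prod_eq_iff)
  then have "h = 0"
    by (simp add: fun_eq_iff)
  with \<open>f = 0\<close> \<open>u = 0\<close> show "x = 0"
    by (simp add: x zero_prod_def)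
qed

text \<open>The image is a \<open>Z\<close>-stable subspace, so only generators have to be reached.
  In weight zero a vector is corrected by a combination of the \<open>g j\<close> to a cycle, which
  is a boundary plus an element of \<open>P\<close>.\<close>

lemma \<psi>_surjective: "\<psi> ` space_of (S1 \<oplus>\<^sub>R U \<oplus>\<^sub>R S2) = V"
proof
  let ?T = "S1 \<oplus>\<^sub>R U \<oplus>\<^sub>R S2"
  let ?Q = "\<psi> ` space_of ?T"
  show "?Q \<subseteq> V"
    using hom_space[OF rep_hom_target stable_target] by blast
  have Q: "complex_vector.subspace ?Q"
    by (rule linear_on_image_subspace[OF hom_linear[OF rep_hom_target] stable_space_subspace[OF stable_target]])
  have QZ: "Z v \<in> ?Q" if v: "v \<in> ?Q" for v
  proof -
    obtain x where "x \<in> space_of ?T" "v = \<psi> x"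
      using v by blast
    then show ?thesis
      using hom_lie[OF rep_hom_target, of x lie_Z] stable_lie[OF stable_target, of x lie_Z] by (metis imageI)
  qed
  have zeros: "0 \<in> space_of S1" "0 \<in> space_of U" "0 \<in> space_of S2"
    using stable_space_subspace stable_S1 stable_U stable_S2 complex_vector.subspace_0 by blast+
  have sum0: "\<psi>1 0 = 0" "\<psi>2 0 = 0"
    by (simp_all add: sum_map_def)
  have eQ: "e i \<in> ?Q" if i: "i \<in> I" for i
  proof -
    have "weight_hom (\<mu> i) (e i) (1, 0) \<in> \<psi>1 ` space_of S1"
      by (rule sum_map_single[OF i])
        (simp_all add: stable_super_weight_rep super_weight_rep_simps weight_hom_def)
    then obtain f where f: "f \<in> space_of S1" "\<psi>1 f = e i"
      by (auto simp: weight_hom_def scaleC_one)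
    then have "\<psi> (f, 0, 0) = e i" "(f, 0, 0) \<in> space_of ?T"
      using zeros by (simp_all add: \<psi>_def sum0 space_of_rep_plus)
    then show ?thesis
      by (metis imageI)
  qed
  have gQ: "g j \<in> ?Q" if j: "j \<in> J" for j
  proof -
    have "nilpotent_hom (g j) (0, 1) \<in> \<psi>2 ` space_of S2"
      by (rule sum_map_single[OF j]) (simp_all add: stable_W space_of_W nilpotent_hom_def)
    then obtain h where h: "h \<in> space_of S2" "\<psi>2 h = g j"
      by (auto simp: nilpotent_hom_def scaleC_one)
    then have "\<psi> (0, 0, h) = g j" "(0, 0, h) \<in> space_of ?T"
      using zeros by (simp_all add: \<psi>_def sum0 space_of_rep_plus)
    then show ?thesis
      by (metis imageI)
  qed
  have PQ: "u \<in> ?Q" if u: "u \<in> P p" for u p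
  proof -
    have "u \<in> space_of U"
      using u stable_part_subset[OF stable_U, of p] by (auto simp: U_simps)
    then have "\<psi> (0, u, 0) = u" "(0, u, 0) \<in> space_of ?T"
      using zeros by (simp_all add: \<psi>_def sum0 space_of_rep_plus)
    then show ?thesis
      by (metis imageI)
  qed
  have "nonzero_weight_vectors \<subseteq> ?Q"
    using e_spans complex_vector.span_minimal[OF _ Q, of "e ` I"] eQ by blast
  moreover have span_g: "complex_vector.span (g ` J) \<subseteq> ?Q"
    by (rule complex_vector.span_minimal[OF _ Q]) (use gQ in blast)
  have span_Zg: "complex_vector.span ((\<lambda>j. Z (g j)) ` J) \<subseteq> ?Q"
    by (rule complex_vector.span_minimal[OF _ Q]) (use gQ QZ in blast)
  have closedQ: "v \<in> ?Q" if v: "v \<in> closed_part p" for v p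
  proof -
    obtain r u where ru: "r \<in> exact_part p" "u \<in> P p" "v = r + u"
      using P_sum[OF v] by blast
    have "r \<in> Z ` homogeneous_null_vectors"
      using ru(1) by (auto simp: exact_part_def homogeneous_null_vectors_def)
    then have "r \<in> ?Q"
      using Zg_spans span_Zg by blast
    then show ?thesis
      unfolding ru(3) using PQ[OF ru(2)] by (rule complex_vector.subspace_add[OF Q])
  qed
  have homQ: "v \<in> ?Q" if v: "v \<in> homogeneous_null_vectors" for v
  proof -
    have sub: "g ` J \<subseteq> weight_space R 0" "g ` J \<subseteq> V"
      using g_weight weight_space_V by blast+
    have "Z v \<in> complex_vector.span (Z ` g ` J)"
      using Zg_spans v by (auto simp: image_image)
    then obtain x where x: "x \<in> complex_vector.span (g ` J)" "Z x = Z v"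
      using linear_on_span_preimage[OF lie_linear V_subspace sub(2)] by blast
    have w: "v \<in> weight_space R 0" "x \<in> weight_space R 0"
      using v x(1) complex_vector.span_minimal[OF sub(1) weight_space_subspace]
      by (auto simp: homogeneous_null_vectors_def)
    then have "v - x \<in> weight_space R 0"
      by (rule complex_vector.subspace_diff[OF weight_space_subspace])
    \<comment> \<open>\<open>x\<close> may mix parities even though \<open>v\<close> is homogeneous,
      while \<open>P_sum\<close> handles homogeneous cycles only; hence \<open>v - x\<close> is
      split again.\<close>
    then obtain y z where yz: "y \<in> part R 0" "z \<in> part R (0 + 1)" "v - x = y + z"
      using V_split[OF weight_space_V, of _ 0 0] by blast
    then have V: "y \<in> V" "z \<in> V"
      using part_subset by blast+
    have "Z (v - x) = 0"
      using w x(2) by (simp add: linear_on_diff[OF lie_linear V_subspace] weight_space_V)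
    then have eq: "Z z + Z y = 0 + 0"
      unfolding yz using V by (simp add: linear_on_add[OF lie_linear] add.commute)
    have "Z z = 0" "Z y = 0"
      using split_eq[of "Z z" 0 0 "Z y" 0, OF _ _ _ _ eq] Z_part[OF yz(1)] Z_part[OF yz(2)] part_closed(1)
      by auto
    then have "y \<in> ?Q" "z \<in> ?Q"
      using yz closedQ[of y 0] closedQ[of z 1] by (auto simp: closed_part_def)
    then have "x + (y + z) \<in> ?Q"
      using x(1) span_g complex_vector.subspace_add[OF Q] by blast
    then show ?thesis
      using yz(3) by (metis add.commute diff_add_cancel)
  qed
  have "weight_space R 0 \<subseteq> ?Q"
  proof
    fix v assume v: "v \<in> weight_space R 0"
    obtain x y where "x \<in> part R 0" "y \<in> part R (0 + 1)" "v = x + y"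
      "x \<in> weight_space R 0" "y \<in> weight_space R 0"
      using weight_space_zero_split[OF v, of 0] .
    then show "v \<in> ?Q"
      using homQ[of x] homQ[of y] complex_vector.subspace_add[OF Q]
      by (auto simp: homogeneous_null_vectors_def)
  qed
  ultimately show "V \<subseteq> ?Q"
    using QZ by (intro space_of_generated[OF Q])
qed

lemma decomposition: "rep_isomorphic R (S1 \<oplus>\<^sub>R U \<oplus>\<^sub>R S2)"
  using \<psi>_injective \<psi>_surjective
  by (intro rep_isomorphicI[OF rep stable_target rep_hom_target]) (simp add: bij_betw_def)

end

section \<open>Existence of the bases, lifts and complements\<close>

context supercircle
begin

text \<open>The basis is drawn from weight vectors, so it is the union of its intersections with the
  weight spaces. Each of these is finite and there are countably many weights, which gives the
  numbering.\<close>

lemma obtain_even_weight_basis: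
  assumes "\<And>m. finite_dim (weight_space R m)"
  obtains I :: "nat set" and e and \<mu> :: "nat \<Rightarrow> int"
  where "\<And>i. i \<in> I \<Longrightarrow> e i \<in> part R 0 \<and> e i \<in> weight_space R (\<mu> i) \<and> \<mu> i \<noteq> 0"
    "inj_on e I" "complex_vector.independent (e ` I)"
    "nonzero_weight_vectors \<subseteq> complex_vector.span (e ` I)"
proof -
  obtain B where B: "B \<subseteq> nonzero_weight_vectors" "complex_vector.independent B"
    "nonzero_weight_vectors \<subseteq> complex_vector.span B"
    using complex_vector.maximal_independent_subset by blast
  have "finite (B \<inter> weight_space R m)" for m
    using complex_vector.independent_mono[OF B(2), of "B \<inter> weight_space R m"] assms
    by (intro independent_finite_dim_imp_finite[of _ "weight_space R m"]) auto
  then have "countable (\<Union>m. B \<inter> weight_space R m)"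
    by (intro countable_UN) (auto intro: countable_finite)
  moreover have "(\<Union>m. B \<inter> weight_space R m) = B"
    using B(1) by (auto simp: nonzero_weight_vectors_def)
  ultimately obtain I :: "nat set" and e where e: "bij_betw e I B"
    using obtain_nat_enumeration by metis
  then have eI: "e ` I = B" "inj_on e I"
    by (auto simp: bij_betw_def)
  have "\<forall>i\<in>I. \<exists>m. e i \<in> part R 0 \<and> e i \<in> weight_space R m \<and> m \<noteq> 0"
    using B(1) eI(1) by (auto simp: nonzero_weight_vectors_def)
  then obtain \<mu> where "\<forall>i\<in>I. e i \<in> part R 0 \<and> e i \<in> weight_space R (\<mu> i) \<and> \<mu> i \<noteq> 0"
    by (rule bchoice[THEN exE])
  with B eI show thesis
    by (intro that[of I e \<mu>]) auto
qed

text \<open>The basis of the range is chosen among images of homogeneous vectors, not merely in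
  their span, so that every basis element has a homogeneous lift.\<close>

lemma obtain_null_generators:
  assumes "finite_dim (weight_space R 0)"
  obtains J :: "nat set" and g
  where "\<And>j. j \<in> J \<Longrightarrow> g j \<in> homogeneous_null_vectors"
    "inj_on (\<lambda>j. Z (g j)) J" "complex_vector.independent ((\<lambda>j. Z (g j)) ` J)"
    "Z ` homogeneous_null_vectors \<subseteq> complex_vector.span ((\<lambda>j. Z (g j)) ` J)"
proof -
  obtain D where D: "D \<subseteq> Z ` homogeneous_null_vectors" "complex_vector.independent D"
    "Z ` homogeneous_null_vectors \<subseteq> complex_vector.span D"
    using complex_vector.maximal_independent_subset by blast
  have "D \<subseteq> weight_space R 0"
    using D(1) weight_space_Z by (auto simp: homogeneous_null_vectors_def)
  then have "countable D"
    using independent_finite_dim_imp_finite[OF D(2) _ assms] countable_finite by blast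
  then obtain J :: "nat set" and d where "bij_betw d J D"
    using obtain_nat_enumeration by metis
  then have d: "d ` J = D" "inj_on d J"
    by (auto simp: bij_betw_def)
  define g where "g j = inv_into homogeneous_null_vectors Z (d j)" for j
  have g: "g j \<in> homogeneous_null_vectors" "Z (g j) = d j" if "j \<in> J" for j
  proof -
    have "d j \<in> Z ` homogeneous_null_vectors"
      using D(1) d(1) that by blast
    then show "g j \<in> homogeneous_null_vectors" "Z (g j) = d j"
      unfolding g_def by (rule inv_into_into, rule f_inv_into_f)
  qed
  have "(\<lambda>j. Z (g j)) ` J = D"
    unfolding d(1)[symmetric] using g(2) by (intro image_cong) auto
  moreover have "inj_on (\<lambda>j. Z (g j)) J"
    using d(2) g(2) by (simp add: inj_on_def)
  ultimately show thesis
    using D g(1) by (intro that[of J g]) auto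
qed

text \<open>Complements are taken in each parity separately, which makes the trivial summand
  graded.\<close>

lemma obtain_null_complement:
  obtains P where "\<And>p. complex_vector.subspace (P p)" "\<And>p. P p \<subseteq> closed_part p"
    "\<And>p. P p \<inter> exact_part p = {0}"
    "\<And>p x. x \<in> closed_part p \<Longrightarrow> \<exists>s\<in>exact_part p. \<exists>u\<in>P p. x = s + u"
proof -
  have "\<exists>U. complex_vector.subspace U \<and> U \<subseteq> closed_part p \<and> U \<inter> exact_part p = {0} \<and>
      (\<forall>x\<in>closed_part p. \<exists>s\<in>exact_part p. \<exists>u\<in>U. x = s + u)" for p
    using subspace_complement[OF exact_part_closed_part(1,2,3), of p] by metis
  then obtain P where "\<forall>p. complex_vector.subspace (P p) \<and> P p \<subseteq> closed_part p \<and>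
      P p \<inter> exact_part p = {0} \<and> (\<forall>x\<in>closed_part p. \<exists>s\<in>exact_part p. \<exists>u\<in>P p. x = s + u)"
    by metis
  then show thesis
    by (intro that[of P]) auto
qed

end

theorem theorem3p2:
  fixes R :: "'v::complex_vector super_rep"
  assumes "supercircle_rep R"
    and "\<And>m. finite_dim (weight_space R m)"
  shows "\<exists>(I :: nat set) (\<mu> :: nat \<Rightarrow> int) (U :: 'v super_rep)
            (J :: nat set) (W :: nat \<Rightarrow> (complex \<times> complex) super_rep).
           (\<forall>i\<in>I. \<mu> i \<noteq> 0) \<and>
           trivial_rep U \<and>
           (\<forall>j\<in>J. rep_isomorphic (W j) adjoint_rep \<or>
                  rep_isomorphic (W j) (parity_reversal adjoint_rep)) \<and>
           rep_isomorphic R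
             (rep_Sum I (\<lambda>i. super_weight_rep (\<mu> i)) \<oplus>\<^sub>R U \<oplus>\<^sub>R rep_Sum J W)"
proof -
  interpret supercircle R by standard fact
  obtain I :: "nat set" and e and \<mu> :: "nat \<Rightarrow> int" where I:
    "\<And>i. i \<in> I \<Longrightarrow> e i \<in> part R 0 \<and> e i \<in> weight_space R (\<mu> i) \<and> \<mu> i \<noteq> 0"
    "inj_on e I" "complex_vector.independent (e ` I)"
    "nonzero_weight_vectors \<subseteq> complex_vector.span (e ` I)"
    using obtain_even_weight_basis[OF assms(2)] by metis
  obtain J :: "nat set" and g where J: "\<And>j. j \<in> J \<Longrightarrow> g j \<in> homogeneous_null_vectors"
    "inj_on (\<lambda>j. Z (g j)) J" "complex_vector.independent ((\<lambda>j. Z (g j)) ` J)"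
    "Z ` homogeneous_null_vectors \<subseteq> complex_vector.span ((\<lambda>j. Z (g j)) ` J)"
    using obtain_null_generators[OF assms(2)] by metis
  obtain P where P: "\<And>p. complex_vector.subspace (P p)" "\<And>p. P p \<subseteq> closed_part p"
    "\<And>p. P p \<inter> exact_part p = {0}"
    "\<And>p x. x \<in> closed_part p \<Longrightarrow> \<exists>s\<in>exact_part p. \<exists>u\<in>P p. x = s + u"
    using obtain_null_complement by metis
  interpret supercircle_decomposition R I e \<mu> J g P
    by unfold_locales (fact I J P)+
  show ?thesis
    using I(1) trivial_rep_U W_isomorphic decomposition
    by (intro exI[of _ I] exI[of _ \<mu>] exI[of _ U] exI[of _ J] exI[of _ W]) simp
qed

end
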